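(* Let $\Phi$ be a nice extended norm on $\mathbb{R}^\omega$. Then the following are equivalent: (1) $\mathrm{FIN}(\Phi)=\mathrm{EXH}(\Phi)$; (2) $\mathrm{EXH}(\Phi)$ is an $F_\sigma$ subset of $\mathbb{R}^\omega$ (product topology); (3) $\mathrm{EXH}(\Phi)$ does not contain an isomorphic copy of $c_0$, i.e. $(e_n)$ is a boundedly complete basis of $\mathrm{EXH}(\Phi)$; (4) $\mathrm{FIN}(\Phi)$ is separable; (5) the equivalence relation $\mathbb{R}^\omega/\mathrm{EXH}(\Phi)$ is Borel reducible to $\mathbb{R}^\omega/\ell_\infty$; (6) every ideal representable in $\mathrm{EXH}(\Phi)$ is $F_\sigma$; (7) the density zero ideal $\mathcal{Z}$ is not representable in $\mathrm{EXH}(\Phi)$; (8) for every $\sigma\in\mathbb{R}^\omega$, if $\varphi(A)=\Phi(P_A(\sigma))$ for $A\subseteq\omega$, then $\mathrm{Exh}(\varphi)=\mathrm{Fin}(\varphi)$.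
   Context: An extended norm is a function $\Phi\colon\mathbb{R}^\omega\to[0,\infty]$ satisfying the axioms of a norm but possibly taking the value $\infty$. $P_A(x)(n)=x(n)$ for $n\in A$, $0$ otherwise; $P_n=P_{\{0,\dots,n-1\}}$. $c_{00}$ is the space of finitely supported sequences, $(e_n)$ its standard basis. $\Phi$ is nice if (a) $\Phi<\infty$ on $c_{00}$; (b) $|x_n|\le|y_n|$ for all $n$ implies $\Phi(x)\le\Phi(y)$; (c) $\Phi(P_n(x))\to\Phi(x)$. $\mathrm{FIN}(\Phi)=\{x\colon\Phi(x)<\infty\}$, $\mathrm{EXH}(\Phi)=\{x\colon\Phi(P_{\omega\setminus n}(x))\to0\}$, both Banach spaces under $\Phi$. A basis $(e_n)$ is boundedly complete if $\sum a_ne_n$ converges whenever $\sup_N\|\sum_{n<N}a_ne_n\|<\infty$. For a linear subspace $L\subseteq\mathbb{R}^\omega$, $\mathbb{R}^\omega/L$ denotes the equivalence relation $x\sim y\iff x-y\in L$; Borel reducibility of $E$ to $F$ means there is a Borel $f\colon\mathbb{R}^\omega\to\mathbb{R}^\omega$ with $xEy\iff f(x)Ff(y)$. An ideal $\mathcal{I}$ on $\omega$ is representable in a Banach space $X$ if $\mathcal{I}=\{A\subseteq\omega\colon\sum_{n\in A}x_n\text{ is unconditionally convergent in }X\}$ for some sequence $(x_n)$ in $X$; ideals are viewed as subsets of $\mathcal{P}(\omega)\cong2^\omega$. $\mathcal{Z}=\{A\subseteq\omega\setminus\{0\}\colon|A\cap[1,n]|/n\to0\}$. For a submeasure $\varphi$,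 $\mathrm{Fin}(\varphi)=\{A\colon\varphi(A)<\infty\}$ and $\mathrm{Exh}(\varphi)=\{A\colon\lim_n\varphi(A\setminus n)=0\}$. *)

theory Defs
  imports "HOL-Analysis.Analysis" "HOL-Library.Function_Algebras"
begin

text \<open>Sequences carry the pointwise operations of \<^theory>\<open>HOL-Library.Function_Algebras\<close>
  and the product topology of \<^theory>\<open>HOL-Analysis.Function_Topology\<close>.\<close>

type_synonym rseq = "nat \<Rightarrow> real"

definition scale_seq :: "real \<Rightarrow> rseq \<Rightarrow> rseq" where
  "scale_seq c x = (\<lambda>n. c * x n)"

definition unit_seq :: "nat \<Rightarrow> rseq" where
  "unit_seq n = (\<lambda>k. if k = n then 1 else 0)"

definition proj_on :: "nat set \<Rightarrow> rseq \<Rightarrow> rseq" where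
  "proj_on A x = (\<lambda>n. if n \<in> A then x n else 0)"

definition c00 :: "rseq set" where
  "c00 = {x. finite {n. x n \<noteq> 0}}"

definition c0 :: "rseq set" where
  "c0 = {x. x \<longlonglongrightarrow> 0}"

definition linf :: "rseq set" where
  "linf = {x. bounded (range x)}"

definition sup_norm :: "rseq \<Rightarrow> ennreal" where
  "sup_norm x = (SUP n. ennreal \<bar>x n\<bar>)"


section \<open>Extended norms\<close>

definition extended_norm :: "(rseq \<Rightarrow> ennreal) \<Rightarrow> bool" where
  "extended_norm \<Phi> \<longleftrightarrow>
     (\<forall>x. \<Phi> x = 0 \<longleftrightarrow> x = 0) \<and>
     (\<forall>c x. \<Phi> (scale_seq c x) = ennreal \<bar>c\<bar> * \<Phi> x) \<and>
     (\<forall>x y. \<Phi> (x + y) \<le> \<Phi> x + \<Phi> y)"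

definition nice :: "(rseq \<Rightarrow> ennreal) \<Rightarrow> bool" where
  "nice \<Phi> \<longleftrightarrow>
     (\<forall>x\<in>c00. \<Phi> x < \<infinity>) \<and>
     (\<forall>x y. (\<forall>n. \<bar>x n\<bar> \<le> \<bar>y n\<bar>) \<longrightarrow> \<Phi> x \<le> \<Phi> y) \<and>
     (\<forall>x. (\<lambda>n. \<Phi> (proj_on {..<n} x)) \<longlonglongrightarrow> \<Phi> x)"

definition FIN :: "(rseq \<Rightarrow> ennreal) \<Rightarrow> rseq set" where
  "FIN \<Phi> = {x. \<Phi> x < \<infinity>}"

definition EXH :: "(rseq \<Rightarrow> ennreal) \<Rightarrow> rseq set" where
  "EXH \<Phi> = {x. (\<lambda>n. \<Phi> (proj_on (- {..<n}) x)) \<longlonglongrightarrow> 0}"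

text \<open>The topology of a linear space \<open>L\<close> normed by \<open>\<Phi>\<close>.  It is only meaningful if
  \<open>L \<subseteq> FIN \<Phi>\<close>, since \<^const>\<open>enn2real\<close> sends \<open>\<infinity>\<close> to \<open>0\<close>; for nice \<open>\<Phi>\<close> both
  \<open>FIN \<Phi>\<close> and \<open>EXH \<Phi>\<close> qualify.\<close>

definition norm_topology :: "(rseq \<Rightarrow> ennreal) \<Rightarrow> rseq set \<Rightarrow> rseq topology" where
  "norm_topology \<Phi> L = Metric_space.mtopology L (\<lambda>x y. enn2real (\<Phi> (x - y)))"


section \<open>Banach space notions\<close>

text \<open>In the following definitions \<open>(L, \<Phi>)\<close> is a normed space of sequences.\<close>

definition series_converges_to ::
  "(rseq \<Rightarrow> ennreal) \<Rightarrow> rseq set \<Rightarrow> (nat \<Rightarrow> rseq) \<Rightarrow> rseq \<Rightarrow> bool" where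
  "series_converges_to \<Phi> L u s \<longleftrightarrow>
     limitin (norm_topology \<Phi> L) (\<lambda>N. \<Sum>n<N. u n) s sequentially"

definition schauder_basis :: "(rseq \<Rightarrow> ennreal) \<Rightarrow> rseq set \<Rightarrow> (nat \<Rightarrow> rseq) \<Rightarrow> bool" where
  "schauder_basis \<Phi> L b \<longleftrightarrow>
     range b \<subseteq> L \<and>
     (\<forall>x\<in>L. \<exists>!a. series_converges_to \<Phi> L (\<lambda>n. scale_seq (a n) (b n)) x)"

definition boundedly_complete_basis ::
  "(rseq \<Rightarrow> ennreal) \<Rightarrow> rseq set \<Rightarrow> (nat \<Rightarrow> rseq) \<Rightarrow> bool" where
  "boundedly_complete_basis \<Phi> L b \<longleftrightarrow>
     schauder_basis \<Phi> L b \<and>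
     (\<forall>a. (SUP N. \<Phi> (\<Sum>n<N. scale_seq (a n) (b n))) < \<infinity> \<longrightarrow>
       (\<exists>s. series_converges_to \<Phi> L (\<lambda>n. scale_seq (a n) (b n)) s))"

text \<open>\<open>(L, \<Phi>)\<close> contains an isomorphic copy of \<open>(K, \<Psi>)\<close>: there is a linear isomorphism
  (bounded with bounded inverse) of \<open>K\<close> onto a subspace of \<open>L\<close>.\<close>

definition contains_copy ::
  "(rseq \<Rightarrow> ennreal) \<Rightarrow> rseq set \<Rightarrow> (rseq \<Rightarrow> ennreal) \<Rightarrow> rseq set \<Rightarrow> bool" where
  "contains_copy \<Phi> L \<Psi> K \<longleftrightarrow>
     (\<exists>T. T ` K \<subseteq> L \<and>
        (\<forall>x\<in>K. \<forall>y\<in>K. T (x + y) = T x + T y) \<and>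
        (\<forall>c. \<forall>x\<in>K. T (scale_seq c x) = scale_seq c (T x)) \<and>
        (\<exists>m M. 0 < m \<and> 0 < M \<and>
           (\<forall>x\<in>K. ennreal m * \<Psi> x \<le> \<Phi> (T x) \<and> \<Phi> (T x) \<le> ennreal M * \<Psi> x)))"

text \<open>Unconditional convergence is convergence of the net of finite partial sums, as for
  \<^const>\<open>summable_on\<close>; that constant is not applicable because the topology is not the
  one of the type class.\<close>

definition unconditionally_convergent ::
  "(rseq \<Rightarrow> ennreal) \<Rightarrow> rseq set \<Rightarrow> (nat \<Rightarrow> rseq) \<Rightarrow> nat set \<Rightarrow> bool" where
  "unconditionally_convergent \<Phi> L u A \<longleftrightarrow>
     (\<exists>s. limitin (norm_topology \<Phi> L) (sum u) s (finite_subsets_at_top A))"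


section \<open>Ideals and submeasures\<close>

text \<open>The underlying countable set \<open>D\<close> is explicit because the density zero ideal
  lives on \<open>\<omega> \<setminus> {0}\<close>; regarded as a family of subsets of \<open>\<omega>\<close> it would omit the finite
  set \<open>{0}\<close> and so would trivially fail to be representable.  Ideals contain all finite
  sets; properness is not demanded.\<close>

definition ideal_on :: "nat set \<Rightarrow> nat set set \<Rightarrow> bool" where
  "ideal_on D I \<longleftrightarrow>
     I \<subseteq> Pow D \<and>
     (\<forall>A. finite A \<and> A \<subseteq> D \<longrightarrow> A \<in> I) \<and>
     (\<forall>A B. A \<in> I \<and> B \<subseteq> A \<longrightarrow> B \<in> I) \<and>
     (\<forall>A B. A \<in> I \<and> B \<in> I \<longrightarrow> A \<union> B \<in> I)"

definition representable_on ::
  "nat set \<Rightarrow> nat set set \<Rightarrow> (rseq \<Rightarrow> ennreal) \<Rightarrow> rseq set \<Rightarrow> bool" where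
  "representable_on D I \<Phi> L \<longleftrightarrow>
     (\<exists>u. u ` D \<subseteq> L \<and> I = {A. A \<subseteq> D \<and> unconditionally_convergent \<Phi> L u A})"

definition Z_ideal :: "nat set set" where
  "Z_ideal = {A. A \<subseteq> UNIV - {0} \<and> (\<lambda>n. real (card (A \<inter> {1..n})) / real n) \<longlonglongrightarrow> 0}"

text \<open>Being \<open>F\<^sub>\<sigma>\<close> in \<open>\<P>(\<omega>) \<cong> 2\<^sup>\<omega>\<close>, where \<^term>\<open>Collect :: (nat \<Rightarrow> bool) \<Rightarrow> nat set\<close> identifies
  the product \<open>2\<^sup>\<omega>\<close> with \<open>\<P>(\<omega>)\<close>.\<close>

definition fsigma_family :: "nat set set \<Rightarrow> bool" where
  "fsigma_family I \<longleftrightarrow> fsigma_in euclidean (Collect -` I)"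

definition Fin_subm :: "(nat set \<Rightarrow> ennreal) \<Rightarrow> nat set set" where
  "Fin_subm \<phi> = {A. \<phi> A < \<infinity>}"

definition Exh_subm :: "(nat set \<Rightarrow> ennreal) \<Rightarrow> nat set set" where
  "Exh_subm \<phi> = {A. (\<lambda>n. \<phi> (A - {..<n})) \<longlonglongrightarrow> 0}"


section \<open>Borel reducibility\<close>

text \<open>The relation \<open>\<real>\<^sup>\<omega>/L\<close>.\<close>

definition coset_rel :: "rseq set \<Rightarrow> rseq rel" where
  "coset_rel L = {(x, y). x - y \<in> L}"

definition borel_reducible :: "rseq rel \<Rightarrow> rseq rel \<Rightarrow> bool" where
  "borel_reducible E F \<longleftrightarrow>
     (\<exists>f \<in> borel_measurable borel. \<forall>x y. (x, y) \<in> E \<longleftrightarrow> (f x, f y) \<in> F)"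

end

theory Submission
  imports Defs "HOL-Library.Discrete_Functions" "HOL-Library.Nat_Bijection"
begin

text \<open>If \<open>x \<in> FIN - EXH\<close>, cutting \<open>x\<close> into successive finite blocks of norm at least \<open>\<epsilon>\<close> gives a map
  \<open>\<real>\<^sup>\<omega> \<rightarrow> \<real>\<^sup>\<omega>\<close>, linear and continuous, under which the preimage of \<open>EXH\<close> is \<open>c\<^sub>0\<close> and which restricts to
  an isomorphic embedding of \<open>c\<^sub>0\<close>.  Weighting the point \<open>(m, j)\<close> of \<open>\<omega> \<times> \<omega>\<close> by \<open>2\<^sup>-\<^sup>m\<close> reduces the ideal
  \<open>\<emptyset> \<times> Fin\<close> to \<open>c\<^sub>0\<close>.  By Baire category this ideal is not \<open>F\<^sub>\<sigma>\<close>, and neither is its equivalence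
  relation Borel reducible to \<open>\<real>\<^sup>\<omega>/\<ell>\<^sub>\<infinity>\<close>, since a Borel map is continuous on a comeager set, which contains
  a copy of the whole situation.  This refutes every other condition.  Conversely, if \<open>FIN = EXH\<close> then
  \<open>\<Phi>\<close> is a supremum of countably many continuous functions, and a gliding hump argument (in the style of
  Bessaga and Pelczynski) shows that a series with bounded finite subsums converges unconditionally, so
  that ideals representable in \<open>EXH\<close> are \<open>F\<^sub>\<sigma>\<close>.\<close>


section \<open>Baire category in the Cantor space\<close>

text \<open>Every condition is compared with \<open>FIN \<Phi> = EXH \<Phi>\<close> alone, so the
  two cases of this equation settle all equivalences. Two obstacles shape the category part.
  \<open>fin_rows\<close> is itself meagre in the Cantor space, so Baire's theorem is applied to
  \<open>nat \<Rightarrow> nat\<close>, whose points prescribe the finite rows one by one. For the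
  same reason, the comeager set on which a Borel map is continuous may miss all of
  \<open>fin_rows\<close>; hence a whole cube is embedded in that set, by a map that preserves the
  rows in which two points differ. The density zero ideal is tied to the same test object: densities
  over dyadic intervals turn it into a c0 condition, so it is represented by the same blocks as
  \<emptyset> \<times> Fin, and a code turns any representation of it into a description of
  \<open>fin_rows\<close>.\<close>

lemma open_seq_contains_cylinder:
  fixes U :: "(nat \<Rightarrow> 'a::topological_space) set"
  assumes "open U" "x \<in> U"
  shows "\<exists>n. \<forall>y. (\<forall>i<n. y i = x i) \<longrightarrow> y \<in> U"
proof -
  have "openin (product_topology (\<lambda>i. euclidean) UNIV) U"
    using assms by (simp add: euclidean_product_topology)
  from product_topology_open_contains_basis[OF this \<open>x \<in> U\<close>]
  obtain X where X: "x \<in> (\<Pi>\<^sub>E i\<in>UNIV. X i)" "finite {i. X i \<noteq> topspace (euclidean::'a topology)}"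
    "(\<Pi>\<^sub>E i\<in>UNIV. X i) \<subseteq> U" by blast
  then obtain n where n: "\<forall>i\<in>{i. X i \<noteq> UNIV}. i < n"
    by (metis finite_nat_set_iff_bounded topspace_euclidean)
  have "y \<in> U" if "\<forall>i<n. y i = x i" for y
  proof -
    have "y i \<in> X i" for i
      using X(1) n that by (cases "X i = UNIV") (auto simp: PiE_iff)
    then show ?thesis using X(3) by (auto simp: PiE_iff)
  qed
  then show ?thesis by blast
qed

lemma open_cylinder:
  fixes x :: "nat \<Rightarrow> 'a::discrete_topology"
  shows "open {y. \<forall>i<n. y i = x i}"
proof -
  have "open ((\<lambda>y. y i) -` {x i})" for i
    by (intro open_vimage open_discrete continuous_on_product_coordinates)
  then have "open {y. y i = x i}" for i
    by (simp add: vimage_def)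
  then have "open (\<Inter>i\<in>{..<n}. {y. y i = x i})" by (intro open_INT) auto
  also have "(\<Inter>i\<in>{..<n}. {y. y i = x i}) = {y. \<forall>i<n. y i = x i}" by auto
  finally show ?thesis .
qed

section \<open>Rows of the pairing function and the ideal \<emptyset> \<times> Fin\<close>

definition row :: "nat \<Rightarrow> nat" where
  "row i = fst (prod_decode i)"

text \<open>Under the pairing of \<^const>\<open>prod_decode\<close>, the members of \<open>fin_rows\<close> are the characteristic
  functions of the ideal \<open>\<emptyset> \<times> Fin\<close> on \<open>\<omega> \<times> \<omega>\<close>.\<close>

definition fin_rows :: "(nat \<Rightarrow> bool) set" where
  "fin_rows = {z. \<forall>m. finite {i. z i \<and> row i = m}}"

lemma row_prod_encode [simp]: "row (prod_encode (m, j)) = m"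
  by (simp add: row_def)

lemma row_le: "row i \<le> i"
  using le_prod_encode_1[of "fst (prod_decode i)" "snd (prod_decode i)"] by (simp add: row_def)

lemma snd_prod_decode_le: "snd (prod_decode i) \<le> i"
  using le_prod_encode_2[of "snd (prod_decode i)" "fst (prod_decode i)"] by simp

lemma infinite_row: "infinite {i. row i = m}"
proof -
  have "range (\<lambda>j. prod_encode (m, j)) \<subseteq> {i. row i = m}" by auto
  moreover have "infinite (range (\<lambda>j. prod_encode (m, j)))"
    by (intro range_inj_infinite injI) (simp add: prod_encode_eq)
  ultimately show ?thesis using finite_subset by blast
qed

text \<open>A function \<open>h\<close> prescribes row \<open>m\<close> as the finite set coded by
  the number \<open>h m\<close>. This maps \<open>nat \<Rightarrow> nat\<close> continuously into
  \<open>fin_rows\<close>, so by Baire's theorem some \<open>C n\<close> holds all choices that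
  agree with some \<open>h0\<close> on finitely many rows. The other rows are then arbitrary finite
  sets, and closedness lets them grow to full rows.\<close>

lemma fin_rows_closed_cover:
  assumes closed: "\<And>n::nat. closed (C n)" and cover: "fin_rows \<subseteq> (\<Union>n. C n)"
  obtains n z where "z \<in> C n" "z \<notin> fin_rows"
proof -
  define r :: "(nat \<Rightarrow> nat) \<Rightarrow> nat \<Rightarrow> bool"
    where "r h i \<longleftrightarrow> snd (prod_decode i) \<in> set_decode (h (row i))" for h i
  have r: "r h \<in> fin_rows" for h
  proof -
    have "finite {i. r h i \<and> row i = m}" for m
    proof (rule finite_subset)
      show "{i. r h i \<and> row i = m} \<subseteq> (\<lambda>j. prod_encode (m, j)) ` set_decode (h m)"
        unfolding r_def row_def
        by clarify (metis imageI prod.collapse prod_decode_inverse)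
    qed auto
    then show ?thesis by (auto simp: fin_rows_def)
  qed
  have "continuous_on UNIV (\<lambda>h. r h i)" for i
  proof -
    have "continuous_on UNIV ((\<lambda>k. snd (prod_decode i) \<in> set_decode k) \<circ> (\<lambda>h. h (row i)))"
      by (intro continuous_on_compose continuous_on_product_coordinates) simp
    then show ?thesis unfolding r_def by (simp add: o_def)
  qed
  then have cont: "continuous_on UNIV r"
    by (rule continuous_on_coordinatewise_then_product)
  have cl: "closed (r -` C n)" for n
    using closed_vimage[OF closed cont] .
  have un: "\<Union>(range (\<lambda>n. r -` C n)) = UNIV"
  proof -
    have "\<exists>n. r h \<in> C n" for h using subsetD[OF cover r[of h]] by simp
    then show ?thesis by auto
  qed
  have "(euclidean :: nat topology) = discrete_topology UNIV"
    by (simp add: topology_eq open_discrete)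
  then have "completely_metrizable_space (product_topology (\<lambda>i::nat. euclidean :: nat topology) UNIV)"
    by (simp add: completely_metrizable_space_product_topology completely_metrizable_space_discrete_topology)
  then have cm: "completely_metrizable_space (euclidean :: (nat \<Rightarrow> nat) topology)"
    by (simp only: euclidean_product_topology)
  have "\<exists>n. interior (r -` C n) \<noteq> {}"
  proof (rule ccontr)
    assume *: "\<not> ?thesis"
    have "closedin euclidean T \<and> euclidean interior_of T = {}" if T: "T \<in> range (\<lambda>n. r -` C n)" for T
    proof -
      obtain n where "T = r -` C n" using T by blast
      moreover have "interior (r -` C n) = {}" using * by blast
      ultimately show ?thesis using cl[of n] by (simp only: euclidean_interior_of closed_closedin)
    qed
    then have "euclidean interior_of \<Union>(range (\<lambda>n. r -` C n)) = {}"
      by (rule Baire_category_alt[OF disjI1[OF cm] countable_image[OF countableI_type]])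
    then show False unfolding un by simp
  qed
  then obtain n h0 where h0: "h0 \<in> interior (r -` C n)" by blast
  obtain N where N: "\<And>h. (\<forall>i<N. h i = h0 i) \<Longrightarrow> h \<in> interior (r -` C n)"
    using open_seq_contains_cylinder[OF open_interior h0] by metis
  \<comment> \<open>Rows below \<open>N\<close> as prescribed by \<open>h0\<close>, all others full:
    a limit of points \<open>r h\<close> with \<open>h\<close> in the neighbourhood of
    \<open>h0\<close>.\<close>
  define z where "z i \<longleftrightarrow> (row i < N \<longrightarrow> r h0 i)" for i
  have "{i. z i \<and> row i = N} = {i. row i = N}" by (auto simp: z_def)
  then have "infinite {i. z i \<and> row i = N}" by (simp add: infinite_row)
  then have "z \<notin> fin_rows" unfolding fin_rows_def by blast
  moreover have "z \<in> C n"
  proof (rule ccontr)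
    assume "z \<notin> C n"
    then obtain K where K: "\<And>y. (\<forall>i<K. y i = z i) \<Longrightarrow> y \<notin> C n"
      using open_seq_contains_cylinder[of "- C n" z] closed[of n] by auto
    \<comment> \<open>Filling the rows from \<open>N\<close> on up to column \<open>K\<close> is
      enough to agree with \<open>z\<close> below \<open>K\<close>, because a column number never
      exceeds the code of its point.\<close>
    define h where "h i = (if i < N then h0 i else set_encode {..<K})" for i
    have "h \<in> interior (r -` C n)" by (rule N) (simp add: h_def)
    then have "r h \<in> C n" using interior_subset by blast
    moreover have "r h i = z i" if "i < K" for i
      using that snd_prod_decode_le[of i] unfolding r_def z_def h_def by auto
    ultimately show False using K by blast
  qed
  ultimately show ?thesis using that by blast
qed

section \<open>Meagre sets, the Baire property and Borel functions\<close>

definition meager :: "'a::topological_space set \<Rightarrow> bool" where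
  "meager M \<longleftrightarrow> (\<exists>N::nat \<Rightarrow> 'a set. (\<forall>n. closed (N n) \<and> interior (N n) = {}) \<and> M \<subseteq> (\<Union>n. N n))"

lemma meager_subset: "meager M \<Longrightarrow> M' \<subseteq> M \<Longrightarrow> meager M'"
  unfolding meager_def by blast

lemma meager_nowhere_dense: "closed M \<Longrightarrow> interior M = {} \<Longrightarrow> meager M"
  unfolding meager_def by (intro exI[of _ "\<lambda>_. M"]) auto

lemma meager_UN:
  assumes "\<And>n::nat. meager (M n)"
  shows "meager (\<Union>n. M n)"
proof -
  obtain N where N: "\<And>n k. closed (N n (k::nat)) \<and> interior (N n k) = {}"
    "\<And>n. M n \<subseteq> (\<Union>k. N n k)"
    using assms unfolding meager_def by metis
  show ?thesis unfolding meager_def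
  proof (intro exI conjI allI)
    show "closed (case_prod N (prod_decode k))" "interior (case_prod N (prod_decode k)) = {}" for k
      using N(1) by (auto simp: split_beta)
    show "(\<Union>n. M n) \<subseteq> (\<Union>k. case_prod N (prod_decode k))"
    proof
      fix x assume "x \<in> (\<Union>n. M n)"
      then obtain n where "x \<in> M n" by blast
      then obtain k where "x \<in> N n k" using N(2) by blast
      then have "x \<in> case_prod N (prod_decode (prod_encode (n, k)))" by simp
      then show "x \<in> (\<Union>k. case_prod N (prod_decode k))" by (rule UN_I[OF UNIV_I])
    qed
  qed
qed

lemma meager_Un:
  assumes "meager A" "meager B"
  shows "meager (A \<union> B)"
proof -
  have "meager (\<Union>n::nat. if n = 0 then A else B)"
    using assms by (intro meager_UN) simp
  moreover have "A \<union> B \<subseteq> (\<Union>n::nat. if n = 0 then A else B)"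
    using UN_upper[of 0 UNIV "\<lambda>n::nat. if n = 0 then A else B"]
      UN_upper[of 1 UNIV "\<lambda>n::nat. if n = 0 then A else B"] by simp
  ultimately show ?thesis by (rule meager_subset)
qed

definition baire_property :: "'a::topological_space set \<Rightarrow> bool" where
  "baire_property A \<longleftrightarrow> (\<exists>U. open U \<and> meager ((A - U) \<union> (U - A)))"

text \<open>Sets that agree with an open set up to a meagre set form a sigma-algebra containing the
  open sets.\<close>

lemma borel_baire_property:
  assumes "A \<in> sets borel"
  shows "baire_property A"
proof -
  have "A \<in> sigma_sets UNIV {S. open S}"
    using assms by (simp add: borel_def)
  then show ?thesis
  proof induction
    case (Basic A)
    then show ?case unfolding baire_property_def
      by (intro exI[of _ A]) (auto intro: meager_nowhere_dense)
  next
    case Empty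
    show ?case unfolding baire_property_def
      by (intro exI[of _ "{}"]) (auto intro: meager_nowhere_dense)
  next
    case (Compl A)
    then obtain U where U: "open U" "meager ((A - U) \<union> (U - A))"
      unfolding baire_property_def by blast
    \<comment> \<open>The complement of \<open>U\<close> is closed, not open; replacing it by its
      interior costs only its boundary, which is nowhere dense.\<close>
    have "meager (- U - interior (- U))"
    proof (rule meager_nowhere_dense)
      show "closed (- U - interior (- U))"
        using U(1) by (intro closed_Diff) auto
      show "interior (- U - interior (- U)) = {}"
        using interior_mono[of "- U - interior (- U)" "- U"] interior_subset[of "- U - interior (- U)"]
        by blast
    qed
    with U(2) have "meager (((A - U) \<union> (U - A)) \<union> (- U - interior (- U)))"
      by (rule meager_Un)
    then show ?case unfolding baire_property_def
      using interior_subset[of "- U"]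
      by (intro exI[of _ "interior (- U)"] conjI) (auto elim!: meager_subset)
  next
    case (Union A)
    then obtain U where U: "\<And>i. open (U i)" "\<And>i. meager ((A i - U i) \<union> (U i - A i))"
      unfolding baire_property_def by metis
    have "meager ((\<Union>i. A i) - (\<Union>i. U i) \<union> ((\<Union>i. U i) - (\<Union>i. A i)))"
      using meager_UN[of "\<lambda>i. A i - U i \<union> (U i - A i)", OF U(2)] by (rule meager_subset) blast
    then show ?case unfolding baire_property_def using U(1) by blast
  qed
qed

text \<open>Each preimage of a subbasic set is open up to a meagre set. Removing these meagre sets
  for a countable subbasis makes all the preimages relatively open.\<close>

lemma borel_measurable_continuous_on_comeager:
  fixes f :: "'a::topological_space \<Rightarrow> 'b::second_countable_topology"
  assumes "f \<in> borel_measurable borel"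
  obtains N :: "nat \<Rightarrow> 'a set" where "\<And>n. closed (N n)" "\<And>n. interior (N n) = {}"
    "continuous_on (- (\<Union>n. N n)) f"
proof -
  obtain B :: "'b set set" where B: "countable B" "open = generate_topology B"
    using ex_countable_subbasis by (metis (no_types, lifting) )
  \<comment> \<open>Adding \<open>UNIV\<close> guarantees a nonempty set to enumerate and keeps all
    its members open.\<close>
  define b where "b = from_nat_into (insert UNIV B)"
  have rb: "range b = insert UNIV B"
    unfolding b_def using B(1) by (intro range_from_nat_into) auto
  have op: "open (b n)" for n
  proof -
    have "b n \<in> insert UNIV B" using rb by blast
    then show ?thesis by (metis B(2) generate_topology.Basis insertE open_UNIV)
  qed
  have "baire_property (f -` b n)" for n
    using measurable_sets[OF assms borel_open[OF op[of n]]]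
    by (intro borel_baire_property) simp
  then obtain U where U: "\<And>n. open (U n)" "\<And>n. meager ((f -` b n - U n) \<union> (U n - f -` b n))"
    unfolding baire_property_def by metis
  obtain N :: "nat \<Rightarrow> 'a set" where N: "\<And>n. closed (N n)" "\<And>n. interior (N n) = {}"
     "(\<Union>n. (f -` b n - U n) \<union> (U n - f -` b n)) \<subseteq> (\<Union>n. N n)"
    using meager_UN[of "\<lambda>n. (f -` b n - U n) \<union> (U n - f -` b n)", OF U(2)] unfolding meager_def by blast
  have "continuous_on (- (\<Union>n. N n)) f"
  proof (rule continuous_on_generate_topology[OF B(2)])
    fix V assume "V \<in> B"
    then obtain n where n: "V = b n" using rb by blast
    show "\<exists>A. open A \<and> A \<inter> - (\<Union>n. N n) = f -` V \<inter> - (\<Union>n. N n)"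
      using N(3) by (intro exI[of _ "U n"]) (use U(1) in \<open>auto simp: n\<close>)
  qed
  then show ?thesis using N(1,2) that by blast
qed

text \<open>The prefixes in \<open>P\<close> are treated in turn, each lengthening the pattern
  already found. That one pattern works after every prefix is what later allows free coordinates
  before it.\<close>

lemma nowhere_dense_avoiding_pattern:
  fixes V :: "(nat \<Rightarrow> 'a::discrete_topology) set"
  assumes V: "closed V" "interior V = {}" and P: "finite P"
  shows "\<exists>n'\<ge>n. \<exists>t. \<forall>s\<in>P. \<forall>y. (\<forall>i<n. y i = s i) \<and> (\<forall>i\<in>{n..<n'}. y i = t i) \<longrightarrow> y \<notin> V"
  using P
proof induction
  case empty
  then show ?case by auto
next
  case (insert s P)
  then obtain n' t where nt: "n' \<ge> n"
    "\<And>s y. s \<in> P \<Longrightarrow> (\<forall>i<n. y i = s i) \<Longrightarrow> (\<forall>i\<in>{n..<n'}. y i = t i) \<Longrightarrow> y \<notin> V"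
    by blast
  define x where "x i = (if i < n then s i else t i)" for i
  have "\<not> {y. \<forall>i<n'. y i = x i} \<subseteq> V"
    using interior_maximal[OF _ open_cylinder, of n' x V] V(2) by auto
  then obtain z where z: "\<And>i. i < n' \<Longrightarrow> z i = x i" "z \<notin> V" by blast
  obtain m where m: "\<And>y. (\<forall>i<m. y i = z i) \<Longrightarrow> y \<notin> V"
    using open_seq_contains_cylinder[of "- V" z] z(2) V(1) by auto
  have "y \<notin> V" if "s' \<in> insert s P" "\<forall>i<n. y i = s' i" "\<forall>i\<in>{n..<max n' m}. y i = z i" for s' y
  proof (cases "s' = s")
    case True
    show ?thesis
    proof (intro m allI impI)
      fix i assume "i < m"
      then show "y i = z i"
        using that True z(1)[of i] nt(1) by (cases "i < n") (auto simp: x_def)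
    qed
  next
    case False
    then show ?thesis
      using that nt z(1) by (intro nt(2)[of s' y]) (auto simp: x_def)
  qed
  then show ?case using nt(1) by (intro exI[of _ "max n' m"]) (auto intro!: exI[of _ z])
qed

text \<open>Supplies the block number in the three constructions by successive cuts: the cube in a
  comeager set, the gliding hump, and the blocks of an element outside \<open>EXH\<close>.\<close>

lemma block_index_unique:
  fixes a :: "nat \<Rightarrow> nat"
  assumes "strict_mono a" "a k \<le> i" "i < a (Suc k)"
  shows "(LEAST k. i < a (Suc k)) = k"
proof (rule Least_equality)
  show "i < a (Suc k)" by fact
  show "k \<le> k'" if "i < a (Suc k')" for k'
    using assms(2) that by (metis assms(1) leD le_less_trans not_less_eq_eq strict_mono_less_eq)
qed

lemma block_index_bounds:
  fixes a :: "nat \<Rightarrow> nat"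
  assumes "strict_mono a" "a 0 = 0"
  shows "a (LEAST k. i < a (Suc k)) \<le> i" "i < a (Suc (LEAST k. i < a (Suc k)))"
proof -
  have ex: "i < a (Suc i)"
    using strict_mono_imp_increasing[OF assms(1), of "Suc i"] by simp
  then show "i < a (Suc (LEAST k. i < a (Suc k)))" by (rule LeastI)
  show "a (LEAST k. i < a (Suc k)) \<le> i"
  proof (cases "LEAST k. i < a (Suc k)")
    case 0
    then show ?thesis using assms(2) by simp
  next
    case (Suc k)
    then show ?thesis using not_less_Least[of k "\<lambda>k. i < a (Suc k)"] by auto
  qed
qed

text \<open>Every second interval carries a pattern forcing membership in the comeager set; the other
  intervals hold one free coordinate each, chosen in the row prescribed by \<^const>\<open>row\<close>.\<close>

lemma comeager_contains_fin_rows_cube: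
  fixes N :: "nat \<Rightarrow> (nat \<Rightarrow> bool) set"
  assumes N: "\<And>n. closed (N n)" "\<And>n. interior (N n) = {}"
  obtains \<theta> :: "(nat \<Rightarrow> bool) \<Rightarrow> nat \<Rightarrow> bool" where "continuous_on UNIV \<theta>"
    "\<And>z n. \<theta> z \<notin> N n"
    "\<And>z z'. (\<lambda>i. \<theta> z i \<noteq> \<theta> z' i) \<in> fin_rows \<longleftrightarrow> (\<lambda>i. z i \<noteq> z' i) \<in> fin_rows"
proof -
  \<comment> \<open>Increasing unions, so that leaving \<open>V k\<close> for infinitely many
    \<open>k\<close> means leaving every \<open>N n\<close>.\<close>
  define V where "V k = (\<Union>j\<le>k. N j)" for k
  have clV: "closed (V k)" for k unfolding V_def using N(1) by (intro closed_UN) auto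
  have intV: "interior (V k) = {}" for k
  proof (induction k)
    case 0
    then show ?case by (simp add: V_def N)
  next
    case (Suc k)
    have "V (Suc k) = N (Suc k) \<union> V k" by (auto simp: V_def atMost_Suc)
    then show ?case using Suc N clV by (simp add: interior_closed_Un_empty_interior)
  qed
  have "\<exists>n' t. n < n' \<and> (\<forall>m\<le>k. prod_encode (m, n) < n') \<and>
          (\<forall>y. (\<forall>i\<in>{n..<n'}. y i = t i) \<longrightarrow> y \<notin> V k)" for n k
  proof -
    \<comment> \<open>All prefixes of length \<open>n\<close>, padded by \<open>False\<close> to
      make the set finite.\<close>
    define P where "P = {s::nat \<Rightarrow> bool. \<forall>i. i \<notin> {..<n} \<longrightarrow> s i = False}"
    have "finite P"
      unfolding P_def using finite_set_of_finite_funs[of "{..<n}" "UNIV::bool set" False]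
      by (rule rev_finite_subset) auto
    then obtain n' t where "n \<le> n'"
      and t: "\<forall>s\<in>P. \<forall>y. (\<forall>i<n. y i = s i) \<and> (\<forall>i\<in>{n..<n'}. y i = t i) \<longrightarrow> y \<notin> V k"
      using nowhere_dense_avoiding_pattern[OF clV intV, of P n k] by metis
    note nt = \<open>n \<le> n'\<close> t[rule_format, OF _ conjI, rule_format]
    \<comment> \<open>Beyond the pattern, the block must be long enough to hold a point of each row
      \<open>m \<le> k\<close>; the code of \<open>(m, n)\<close> is one, since it is at least
      \<open>n\<close>.\<close>
    define n'' where "n'' = Suc (n' + (\<Sum>m\<le>k. prod_encode (m, n)))"
    have "prod_encode (m, n) < n''" if "m \<le> k" for m
      using member_le_sum[of m "{..k}" "\<lambda>m. prod_encode (m, n)"] that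
      by (simp add: n''_def)
    moreover have "y \<notin> V k" if "\<forall>i\<in>{n..<n''}. y i = t i" for y
      using that by (intro nt(2)[of "\<lambda>i. i < n \<and> y i"]) (auto simp: P_def n''_def)
    ultimately show ?thesis using nt(1)
      by (intro exI[of _ n''] exI[of _ t]) (auto simp: n''_def)
  qed
  then obtain nx tt where nx: "\<And>n k. n < nx n k" "\<And>n k m. m \<le> k \<Longrightarrow> prod_encode (m, n) < nx n k"
    "\<And>n k y. (\<forall>i\<in>{n..<nx n k}. y i = tt n k i) \<Longrightarrow> y \<notin> V k"
    by metis
  define a where "a = rec_nat 0 (\<lambda>k n. nx n k)"
  have a: "a 0 = 0" "\<And>k. a (Suc k) = nx (a k) k" by (simp_all add: a_def)
  have mono: "strict_mono a" using nx(1) by (simp add: strict_mono_Suc_iff a)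
  define \<kappa> where "\<kappa> i = (LEAST k. i < a (Suc k))" for i
  have \<kappa>: "\<kappa> i = k" if "a k \<le> i" "i < a (Suc k)" for i k
    using block_index_unique[OF mono that] by (simp add: \<kappa>_def)
  \<comment> \<open>The coordinate that carries \<open>z k\<close>: inside block
    \<open>Suc (2 * k)\<close>, and in row \<open>row k\<close> so that rows are preserved. The
    block is long enough since \<open>row k \<le> k\<close>.\<close>
  define c where "c k = prod_encode (row k, a (Suc (2 * k)))" for k
  have \<kappa>c: "\<kappa> (c k) = Suc (2 * k)" for k
  proof (rule \<kappa>)
    show "a (Suc (2 * k)) \<le> c k" unfolding c_def by (rule le_prod_encode_2)
    have "row k \<le> Suc (2 * k)" using row_le[of k] by simp
    then show "c k < a (Suc (Suc (2 * k)))" unfolding c_def a(2)[of "Suc _"] by (rule nx(2))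
  qed
  have injc: "inj c"
    by (rule injI) (metis \<kappa>c nat.inject mult_left_cancel zero_neq_numeral)
  define \<theta> where "\<theta> z i = (if even (\<kappa> i) then tt (a (\<kappa> i)) (\<kappa> i) i
      else i = c (\<kappa> i div 2) \<and> z (\<kappa> i div 2))" for z i
  show ?thesis
  proof
    show "continuous_on UNIV \<theta>"
    proof (rule continuous_on_coordinatewise_then_product)
      show "continuous_on UNIV (\<lambda>z. \<theta> z i)" for i
      proof -
        have "continuous_on UNIV ((\<lambda>b. if even (\<kappa> i) then tt (a (\<kappa> i)) (\<kappa> i) i else i = c (\<kappa> i div 2) \<and> b)
          \<circ> (\<lambda>z. z (\<kappa> i div 2)))"
          by (intro continuous_on_compose continuous_on_product_coordinates) simp
        then show ?thesis by (simp add: \<theta>_def o_def)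
      qed
    qed
    show "\<theta> z \<notin> N n" for z n
    proof -
      have "\<theta> z \<notin> V (2 * n)"
        by (rule nx(3)[of "a (2 * n)" "2 * n"]) (auto simp: \<theta>_def \<kappa> simp flip: a(2))
      then show ?thesis by (auto simp: V_def)
    qed
    show "(\<lambda>i. \<theta> z i \<noteq> \<theta> z' i) \<in> fin_rows \<longleftrightarrow> (\<lambda>i. z i \<noteq> z' i) \<in> fin_rows" for z z'
    proof -
      \<comment> \<open>The two points agree on the patterns, so they differ exactly at the carriers
        of differing coordinates, row by row.\<close>
      have eq: "{i. \<theta> z i \<noteq> \<theta> z' i \<and> row i = m} = c ` {k. z k \<noteq> z' k \<and> row k = m}" for m
      proof (intro equalityI subsetI)
        fix i assume i: "i \<in> {i. \<theta> z i \<noteq> \<theta> z' i \<and> row i = m}"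
        then have "i = c (\<kappa> i div 2)" "z (\<kappa> i div 2) \<noteq> z' (\<kappa> i div 2)"
          by (auto simp: \<theta>_def split: if_splits)
        moreover from this(1) i have "row (\<kappa> i div 2) = m"
          by (metis (mono_tags, lifting) c_def mem_Collect_eq row_prod_encode)
        ultimately show "i \<in> c ` {k. z k \<noteq> z' k \<and> row k = m}" by blast
      next
        fix i assume "i \<in> c ` {k. z k \<noteq> z' k \<and> row k = m}"
        then show "i \<in> {i. \<theta> z i \<noteq> \<theta> z' i \<and> row i = m}"
          by (auto simp: \<theta>_def \<kappa>c) (auto simp: c_def)
      qed
      show ?thesis unfolding fin_rows_def mem_Collect_eq eq
        using finite_imageD[OF _ inj_on_subset[OF injc subset_UNIV]] by blast
    qed
  qed
qed

text \<open>Composed with the cube \<open>\<theta>\<close>, a Borel reduction becomes continuous in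
  each coordinate. The class of the constant sequence \<open>o'\<close> is \<open>fin_rows\<close>,
  and bounding the sup distance from its image by \<open>n\<close> writes this class as a union of
  closed sets \<open>C n\<close>, against \<open>fin_rows_closed_cover\<close>.\<close>

lemma no_borel_reduction_fin_rows_linf:
  fixes g :: "(nat \<Rightarrow> bool) \<Rightarrow> nat \<Rightarrow> real"
  assumes g: "g \<in> borel_measurable borel"
    and red: "\<And>z z'. (\<lambda>i. z i \<noteq> z' i) \<in> fin_rows \<longleftrightarrow> g z - g z' \<in> linf"
  shows False
proof -
  obtain N :: "nat \<Rightarrow> (nat \<Rightarrow> bool) set" where N: "\<And>n. closed (N n)" "\<And>n. interior (N n) = {}"
    "continuous_on (- (\<Union>n. N n)) g"
    by (rule borel_measurable_continuous_on_comeager[OF g]) (rule that)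
  obtain \<theta> :: "(nat \<Rightarrow> bool) \<Rightarrow> nat \<Rightarrow> bool" where \<theta>: "continuous_on UNIV \<theta>"
    "\<And>z n. \<theta> z \<notin> N n"
    "\<And>z z'. (\<lambda>i. \<theta> z i \<noteq> \<theta> z' i) \<in> fin_rows \<longleftrightarrow> (\<lambda>i. z i \<noteq> z' i) \<in> fin_rows"
    by (rule comeager_contains_fin_rows_cube[OF N(1,2)]) (rule that)
  define h where "h z = g (\<theta> z)" for z
  have "\<theta> ` UNIV \<subseteq> - (\<Union>n. N n)" using \<theta>(2) by fastforce
  then have "continuous_on UNIV h"
    unfolding h_def using continuous_on_compose2[OF N(3) \<theta>(1)] by simp
  then have cont: "continuous_on UNIV (\<lambda>z. h z j)" for j
    by (rule continuous_on_product_then_coordinatewise)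
  define o' where "o' = (\<lambda>_::nat. False)"
  define C where "C n = {z. \<forall>j. \<bar>h z j - h o' j\<bar> \<le> real n}" for n
  have mem: "z \<in> fin_rows \<longleftrightarrow> (\<exists>n. z \<in> C n)" for z
  proof -
    have "z \<in> fin_rows \<longleftrightarrow> h z - h o' \<in> linf"
      unfolding h_def red[symmetric] \<theta>(3) by (simp add: o'_def)
    also have "\<dots> \<longleftrightarrow> (\<exists>n::nat. \<forall>j. \<bar>h z j - h o' j\<bar> \<le> real n)"
      unfolding linf_def bounded_iff
      by simp (meson order_trans real_arch_simple)
    finally show ?thesis by (simp add: C_def)
  qed
  have "closed (C n)" for n
    unfolding C_def using cont by (intro closed_Collect_all closed_Collect_le continuous_intros)
  moreover have "fin_rows \<subseteq> (\<Union>n. C n)" using mem by blast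
  ultimately obtain n z where "z \<in> C n" "z \<notin> fin_rows" using fin_rows_closed_cover by blast
  then show False using mem by blast
qed


section \<open>Nice extended norms\<close>

lemma sum_fun_apply: "(sum f A) x = (\<Sum>a\<in>A. f a x)"
  for f :: "'a \<Rightarrow> 'b \<Rightarrow> real"
  by (induction A rule: infinite_finite_induct) auto

lemma proj_on_diff: "proj_on A (x - y) = proj_on A x - proj_on A y"
  by (auto simp: proj_on_def)

lemma proj_on_add: "proj_on A (x + y) = proj_on A x + proj_on A y"
  by (auto simp: proj_on_def)

lemma proj_on_proj_on: "proj_on A (proj_on B x) = proj_on (A \<inter> B) x"
  by (auto simp: proj_on_def)

locale nice_extended_norm =
  fixes \<Phi> :: "rseq \<Rightarrow> ennreal"
  assumes extended_norm: "extended_norm \<Phi>" and nice: "nice \<Phi>"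
begin

lemma norm_zero_iff: "\<Phi> x = 0 \<longleftrightarrow> x = 0"
  using extended_norm unfolding extended_norm_def by blast

lemma norm_zero: "\<Phi> 0 = 0"
  by (simp only: norm_zero_iff)

lemma norm_scale: "\<Phi> (scale_seq c x) = ennreal \<bar>c\<bar> * \<Phi> x"
  using extended_norm unfolding extended_norm_def by blast

lemma norm_triangle: "\<Phi> (x + y) \<le> \<Phi> x + \<Phi> y"
  using extended_norm unfolding extended_norm_def by blast

lemma norm_mono: "(\<And>n. \<bar>x n\<bar> \<le> \<bar>y n\<bar>) \<Longrightarrow> \<Phi> x \<le> \<Phi> y"
  using nice unfolding nice_def by blast

lemma norm_proj_tendsto: "(\<lambda>n. \<Phi> (proj_on {..<n} x)) \<longlonglongrightarrow> \<Phi> x"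
  using nice unfolding nice_def by blast

lemma norm_diff_commute: "\<Phi> (x - y) = \<Phi> (y - x)"
  by (intro antisym norm_mono) (auto simp: abs_minus_commute)

lemma norm_diff_triangle: "\<Phi> (x - y) \<le> \<Phi> x + \<Phi> y"
  using norm_triangle[of x "0 - y"] norm_diff_commute[of 0 y] by simp

lemma norm_triangle3: "\<Phi> (x - z) \<le> \<Phi> (x - y) + \<Phi> (y - z)"
  using norm_triangle[of "x - y" "y - z"] by simp

lemma norm_le_diff: "\<Phi> x \<le> \<Phi> (x - y) + \<Phi> y"
  using norm_triangle[of "x - y" y] by simp

lemma norm_dominated:
  assumes "\<And>n. \<bar>x n\<bar> \<le> c * \<bar>y n\<bar>" "c \<ge> 0"
  shows "\<Phi> x \<le> ennreal c * \<Phi> y"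
proof -
  have "\<Phi> x \<le> \<Phi> (scale_seq c y)"
    using assms by (intro norm_mono) (auto simp: scale_seq_def abs_mult)
  then show ?thesis using assms(2) by (simp add: norm_scale)
qed

lemma norm_sum: "\<Phi> (sum f F) \<le> (\<Sum>i\<in>F. \<Phi> (f i))"
proof (induction F rule: infinite_finite_induct)
  case (insert i F)
  have "\<Phi> (sum f (insert i F)) \<le> \<Phi> (f i) + \<Phi> (sum f F)"
    unfolding sum.insert[OF insert.hyps] by (rule norm_triangle)
  also have "\<dots> \<le> \<Phi> (f i) + (\<Sum>i\<in>F. \<Phi> (f i))" by (intro add_left_mono insert.IH)
  finally show ?case by (simp only: sum.insert[OF insert.hyps])
qed (auto simp: norm_zero_iff)

lemma norm_proj_mono: "A \<subseteq> B \<Longrightarrow> \<Phi> (proj_on A x) \<le> \<Phi> (proj_on B x)"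
  by (intro norm_mono) (auto simp: proj_on_def)

lemma norm_proj_le: "\<Phi> (proj_on A x) \<le> \<Phi> x"
  by (intro norm_mono) (auto simp: proj_on_def)

text \<open>All uses of axiom (c) of niceness go through this bound.\<close>

lemma norm_leI: "(\<And>n. \<Phi> (proj_on {..<n} x) \<le> c) \<Longrightarrow> \<Phi> x \<le> c"
  by (rule LIMSEQ_le_const2[OF norm_proj_tendsto]) auto

lemma norm_finite_support: "finite {n. x n \<noteq> 0} \<Longrightarrow> \<Phi> x < \<infinity>"
  using nice unfolding nice_def c00_def by blast

lemma norm_proj_finite: "finite A \<Longrightarrow> \<Phi> (proj_on A x) < \<infinity>"
  by (intro norm_finite_support) (auto simp: proj_on_def elim: rev_finite_subset)

lemma norm_unit_finite: "\<Phi> (unit_seq i) < \<infinity>"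
  by (intro norm_finite_support) (auto simp: unit_seq_def)

lemma norm_unit_pos: "0 < enn2real (\<Phi> (unit_seq i))"
proof -
  have "unit_seq i \<noteq> 0" by (metis unit_seq_def zero_fun_apply zero_neq_one)
  then show ?thesis using norm_unit_finite[of i]
    by (simp add: enn2real_positive_iff norm_zero_iff zero_less_iff_neq_zero)
qed

lemma norm_unit_eq: "\<Phi> (unit_seq i) = ennreal (enn2real (\<Phi> (unit_seq i)))"
  using norm_unit_finite[of i] by simp

text \<open>Coordinate functionals are bounded, since unit vectors have positive finite norm.
  Together with \<open>norm_proj_le_sum\<close>, this makes \<open>\<Phi>\<close> on finitely many
  coordinates comparable to the coordinates themselves.\<close>

lemma norm_coordinate_le: "ennreal (\<bar>x i\<bar> * enn2real (\<Phi> (unit_seq i))) \<le> \<Phi> x"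
proof -
  have "\<Phi> (scale_seq (x i) (unit_seq i)) \<le> \<Phi> x"
    by (intro norm_mono) (auto simp: scale_seq_def unit_seq_def)
  then show ?thesis using norm_unit_finite[of i] by (simp add: norm_scale ennreal_mult)
qed

lemma norm_proj_le_sum:
  "\<Phi> (proj_on {..<n} x) \<le> ennreal (\<Sum>i<n. \<bar>x i\<bar> * enn2real (\<Phi> (unit_seq i)))"
proof -
  have eq: "proj_on {..<n} x = (\<Sum>i<n. scale_seq (x i) (unit_seq i))"
    by (auto simp: fun_eq_iff proj_on_def sum_fun_apply scale_seq_def unit_seq_def if_distrib[of "(*) _"] cong: if_cong)
  have "\<Phi> (proj_on {..<n} x) \<le> (\<Sum>i<n. \<Phi> (scale_seq (x i) (unit_seq i)))"
    unfolding eq by (rule norm_sum)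
  also have "\<dots> = (\<Sum>i<n. ennreal (\<bar>x i\<bar> * enn2real (\<Phi> (unit_seq i))))"
    by (subst norm_scale, subst norm_unit_eq) (simp add: ennreal_mult)
  also have "\<dots> = ennreal (\<Sum>i<n. \<bar>x i\<bar> * enn2real (\<Phi> (unit_seq i)))"
    by (intro sum_ennreal) simp
  finally show ?thesis .
qed

lemma FIN_iff: "x \<in> FIN \<Phi> \<longleftrightarrow> \<Phi> x < \<infinity>"
  by (simp add: FIN_def)

lemma FIN_bound: "x \<in> FIN \<Phi> \<Longrightarrow> \<exists>B>0. \<Phi> x \<le> ennreal B"
  by (intro exI[of _ "enn2real (\<Phi> x) + 1"]) (auto simp: FIN_def ennreal_plus add_nonneg_pos)

lemma FIN_diff: "x \<in> FIN \<Phi> \<Longrightarrow> y \<in> FIN \<Phi> \<Longrightarrow> x - y \<in> FIN \<Phi>"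
  using norm_diff_triangle[of x y] by (auto simp: FIN_def intro: le_less_trans)

text \<open>Norms of tails decrease, so one small tail makes all later ones small.\<close>

lemma EXH_iff: "x \<in> EXH \<Phi> \<longleftrightarrow> (\<forall>e>0. \<exists>n. \<Phi> (proj_on (- {..<n}) x) < ennreal e)"
proof
  assume "x \<in> EXH \<Phi>"
  then have *: "(\<lambda>n. \<Phi> (proj_on (- {..<n}) x)) \<longlonglongrightarrow> 0" by (simp add: EXH_def)
  show "\<forall>e>0. \<exists>n. \<Phi> (proj_on (- {..<n}) x) < ennreal e"
  proof (intro allI impI)
    fix e :: real assume "e > 0"
    then have "\<forall>\<^sub>F n in sequentially. \<Phi> (proj_on (- {..<n}) x) < ennreal e"
      by (intro order_tendstoD(2)[OF *]) simp
    then show "\<exists>n. \<Phi> (proj_on (- {..<n}) x) < ennreal e"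
      by (auto simp: eventually_sequentially)
  qed
next
  assume *: "\<forall>e>0. \<exists>n. \<Phi> (proj_on (- {..<n}) x) < ennreal e"
  have "(\<lambda>n. \<Phi> (proj_on (- {..<n}) x)) \<longlonglongrightarrow> 0"
  proof (rule order_tendstoI)
    fix a :: ennreal assume "0 < a"
    then obtain r where r: "0 < r" "r < a" using dense by blast
    then obtain e where e: "r = ennreal e" "e > 0"
      by (cases r) (auto simp: less_top[symmetric])
    then obtain n where "\<Phi> (proj_on (- {..<n}) x) < ennreal e" using * by blast
    then have "\<Phi> (proj_on (- {..<m}) x) < a" if "m \<ge> n" for m
      using norm_proj_mono[of "- {..<m}" "- {..<n}" x] that r e by (auto intro: le_less_trans less_trans)
    then show "\<forall>\<^sub>F n in sequentially. \<Phi> (proj_on (- {..<n}) x) < a"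
      by (auto simp: eventually_sequentially)
  qed auto
  then show "x \<in> EXH \<Phi>" by (simp add: EXH_def)
qed

lemma EXH_subset_FIN: "EXH \<Phi> \<subseteq> FIN \<Phi>"
proof
  fix x assume "x \<in> EXH \<Phi>"
  then obtain n where n: "\<Phi> (proj_on (- {..<n}) x) < ennreal 1" using EXH_iff zero_less_one by blast
  have "x = proj_on {..<n} x + proj_on (- {..<n}) x" by (auto simp: proj_on_def)
  then have "\<Phi> x \<le> \<Phi> (proj_on {..<n} x) + \<Phi> (proj_on (- {..<n}) x)" by (metis norm_triangle)
  also have "\<dots> < \<infinity>" using n norm_proj_finite[of "{..<n}" x] by (auto intro: less_trans)
  finally show "x \<in> FIN \<Phi>" by (simp add: FIN_def)
qed

lemma EXH_dominated:
  assumes "x \<in> EXH \<Phi>" "\<And>n. \<bar>y n\<bar> \<le> c * \<bar>x n\<bar>" "c \<ge> 0"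
  shows "y \<in> EXH \<Phi>"
  unfolding EXH_iff
proof (intro allI impI)
  fix e :: real assume "e > 0"
  \<comment> \<open>Dividing by \<open>c + 1\<close> covers the case \<open>c = 0\<close>.\<close>
  with assms obtain n where n: "\<Phi> (proj_on (- {..<n}) x) < ennreal (e / (c + 1))"
    unfolding EXH_iff by (metis add_nonneg_pos divide_pos_pos zero_less_one)
  have "\<Phi> (proj_on (- {..<n}) y) \<le> ennreal c * \<Phi> (proj_on (- {..<n}) x)"
    using assms by (intro norm_dominated) (auto simp: proj_on_def)
  also have "\<dots> \<le> ennreal c * ennreal (e / (c + 1))" using n by (intro mult_left_mono) auto
  also have "\<dots> = ennreal (c * (e / (c + 1)))" 
    using assms \<open>e > 0\<close> by (intro ennreal_mult[symmetric]) auto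
  also have "\<dots> < ennreal e" using assms \<open>e > 0\<close>
    by (intro ennreal_lessI) (auto simp: field_simps)
  finally show "\<exists>n. \<Phi> (proj_on (- {..<n}) y) < ennreal e" by blast
qed

lemma EXH_add:
  assumes "x \<in> EXH \<Phi>" "y \<in> EXH \<Phi>"
  shows "x + y \<in> EXH \<Phi>"
  unfolding EXH_iff
proof (intro allI impI)
  fix e :: real assume "e > 0"
  with assms obtain n m where n: "\<Phi> (proj_on (- {..<n}) x) < ennreal (e / 2)"
    and m: "\<Phi> (proj_on (- {..<m}) y) < ennreal (e / 2)"
    unfolding EXH_iff by (metis half_gt_zero)
  let ?k = "max n m"
  have "\<Phi> (proj_on (- {..<?k}) (x + y)) \<le> \<Phi> (proj_on (- {..<?k}) x) + \<Phi> (proj_on (- {..<?k}) y)"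
    unfolding proj_on_add by (rule norm_triangle)
  also have "\<dots> \<le> \<Phi> (proj_on (- {..<n}) x) + \<Phi> (proj_on (- {..<m}) y)"
    by (intro add_mono norm_proj_mono) auto
  also have "\<dots> < ennreal (e / 2) + ennreal (e / 2)"
    using n m by (rule add_strict_mono)
  also have "\<dots> = ennreal e" using \<open>e > 0\<close> by (simp flip: ennreal_plus)
  finally show "\<exists>n. \<Phi> (proj_on (- {..<n}) (x + y)) < ennreal e" by blast
qed

lemma EXH_diff: "x \<in> EXH \<Phi> \<Longrightarrow> y \<in> EXH \<Phi> \<Longrightarrow> x - y \<in> EXH \<Phi>"
  using EXH_add[of x "0 - y"] EXH_dominated[of y "0 - y" 1] by simp

lemma EXH_finite_support:
  assumes "finite {n. x n \<noteq> 0}"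
  shows "x \<in> EXH \<Phi>"
  unfolding EXH_iff
proof (intro allI impI)
  fix e :: real assume "e > 0"
  obtain n where "\<forall>i\<in>{n. x n \<noteq> 0}. i < n" using assms finite_nat_set_iff_bounded by blast
  then have "proj_on (- {..<n}) x = 0" by (auto simp: proj_on_def fun_eq_iff)
  then have "\<Phi> (proj_on (- {..<n}) x) = 0" by (simp add: norm_zero_iff)
  then show "\<exists>n. \<Phi> (proj_on (- {..<n}) x) < ennreal e" using \<open>e > 0\<close> by (intro exI[of _ n]) simp
qed

lemma EXH_zero: "0 \<in> EXH \<Phi>"
  by (rule EXH_finite_support) simp

lemma EXH_sum: "(\<And>i. i \<in> F \<Longrightarrow> u i \<in> EXH \<Phi>) \<Longrightarrow> sum u F \<in> EXH \<Phi>"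
  by (induction F rule: infinite_finite_induct) (auto simp: EXH_zero EXH_add)

lemma Metric_space_norm:
  assumes "L \<subseteq> FIN \<Phi>"
  shows "Metric_space L (\<lambda>x y. enn2real (\<Phi> (x - y)))"
proof
  have fin: "\<Phi> (x - y) < \<infinity>" if "x \<in> L" "y \<in> L" for x y
    using FIN_diff that assms unfolding FIN_iff[symmetric] by blast
  show "enn2real (\<Phi> (x - y)) = 0 \<longleftrightarrow> x = y" if "x \<in> L" "y \<in> L" for x y
    using fin[OF that] by (auto simp: enn2real_eq_0_iff norm_zero_iff)
  show "enn2real (\<Phi> (x - y)) = enn2real (\<Phi> (y - x))" for x y
    by (simp add: norm_diff_commute[of x y])
  show "enn2real (\<Phi> (x - z)) \<le> enn2real (\<Phi> (x - y)) + enn2real (\<Phi> (y - z))"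
    if "x \<in> L" "y \<in> L" "z \<in> L" for x y z
  proof -
    have "enn2real (\<Phi> (x - z)) \<le> enn2real (\<Phi> (x - y) + \<Phi> (y - z))"
      using fin that by (intro enn2real_mono norm_triangle3) auto
    also have "\<dots> = enn2real (\<Phi> (x - y)) + enn2real (\<Phi> (y - z))"
      using fin that by (intro enn2real_plus) auto
    finally show ?thesis .
  qed
qed auto

lemma enn2real_norm_less_iff:
  assumes "x \<in> FIN \<Phi>" "e > 0"
  shows "enn2real (\<Phi> x) < e \<longleftrightarrow> \<Phi> x < ennreal e"
  using assms by (cases "\<Phi> x") (auto simp: FIN_iff ennreal_less_iff)

lemma limitin_norm_topology_iff:
  assumes "L \<subseteq> FIN \<Phi>"
  shows "limitin (norm_topology \<Phi> L) u s F \<longleftrightarrow>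
    s \<in> L \<and> (\<forall>e>0. \<forall>\<^sub>F i in F. u i \<in> L \<and> \<Phi> (u i - s) < ennreal e)"
proof -
  interpret Metric_space L "\<lambda>x y. enn2real (\<Phi> (x - y))" by (rule Metric_space_norm[OF assms])
  have "enn2real (\<Phi> (u i - s)) < e \<longleftrightarrow> \<Phi> (u i - s) < ennreal e" if "u i \<in> L" "s \<in> L" "e > 0" for e i
    using that assms by (intro enn2real_norm_less_iff FIN_diff) auto
  then show ?thesis
    unfolding norm_topology_def limitin_metric by (auto elim!: eventually_mono)
qed

section \<open>Truncated norms as real functions, continuous for the product topology\<close>

definition proj_norm :: "nat \<Rightarrow> rseq \<Rightarrow> real" where
  "proj_norm n x = enn2real (\<Phi> (proj_on {..<n} x))"

lemma ennreal_proj_norm: "ennreal (proj_norm n x) = \<Phi> (proj_on {..<n} x)"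
  using norm_proj_finite[of "{..<n}" x] by (simp add: proj_norm_def)

lemma proj_norm_nonneg: "0 \<le> proj_norm n x"
  by (simp add: proj_norm_def)

lemma proj_norm_zero: "proj_norm n 0 = 0"
proof -
  have "proj_on {..<n} 0 = 0" by (auto simp: proj_on_def)
  then show ?thesis by (simp only: proj_norm_def norm_zero enn2real_0)
qed

lemma proj_norm_diff_le: "\<bar>proj_norm n x - proj_norm n y\<bar> \<le> proj_norm n (x - y)"
proof -
  have *: "proj_norm n x \<le> proj_norm n (x - y) + proj_norm n y" for x y
    using norm_le_diff[of "proj_on {..<n} x" "proj_on {..<n} y"]
    unfolding proj_on_diff[symmetric] by (simp add: proj_norm_nonneg flip: ennreal_proj_norm ennreal_plus)
  have "proj_norm n (x - y) = proj_norm n (y - x)"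
    by (simp add: proj_norm_def proj_on_diff norm_diff_commute[of "proj_on {..<n} x"])
  then show ?thesis using *[of x y] *[of y x] by linarith
qed

lemma norm_le_iff_proj_norm: "c \<ge> 0 \<Longrightarrow> \<Phi> x \<le> ennreal c \<longleftrightarrow> (\<forall>n. proj_norm n x \<le> c)"
proof -
  assume c: "c \<ge> 0"
  have "\<Phi> x \<le> ennreal c \<longleftrightarrow> (\<forall>n. \<Phi> (proj_on {..<n} x) \<le> ennreal c)"
    using norm_leI norm_proj_le order_trans by metis
  also have "\<dots> \<longleftrightarrow> (\<forall>n. proj_norm n x \<le> c)" using c by (simp flip: ennreal_proj_norm)
  finally show ?thesis .
qed

lemma FIN_iff_proj_norm: "x \<in> FIN \<Phi> \<longleftrightarrow> (\<exists>m::nat. \<forall>n. proj_norm n x \<le> real m)"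
proof
  assume "x \<in> FIN \<Phi>"
  then obtain B where "B > 0" "\<Phi> x \<le> ennreal B" using FIN_bound by blast
  moreover obtain m :: nat where "B \<le> real m" using real_arch_simple by blast
  ultimately show "\<exists>m::nat. \<forall>n. proj_norm n x \<le> real m"
    using norm_le_iff_proj_norm[of B x] by (auto intro: order_trans less_imp_le)
next
  assume "\<exists>m::nat. \<forall>n. proj_norm n x \<le> real m"
  then obtain m where "\<Phi> x \<le> ennreal (real m)" using norm_le_iff_proj_norm of_nat_0_le_iff by blast
  then show "x \<in> FIN \<Phi>" unfolding FIN_iff by (rule le_less_trans) simp
qed

text \<open>By the reverse triangle inequality and \<open>norm_proj_le_sum\<close>, the value
  changes by at most \<open>b\<close>, a weighted sum of the first \<open>n\<close> coordinate
  differences.\<close>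

lemma continuous_on_proj_norm: "continuous_on UNIV (proj_norm n)"
  unfolding continuous_on_def
proof
  fix y :: rseq
  define b where "b x = (\<Sum>i<n. \<bar>x i - y i\<bar> * enn2real (\<Phi> (unit_seq i)))" for x :: rseq
  have "continuous_on UNIV b" unfolding b_def
    by (intro continuous_intros continuous_on_product_coordinates)
  then have "(b \<longlongrightarrow> b y) (at y)" by (simp add: continuous_on_def)
  then have b: "(b \<longlongrightarrow> 0) (at y)" by (simp add: b_def)
  have "norm (proj_norm n x - proj_norm n y) \<le> b x" for x
  proof -
    have "\<bar>proj_norm n x - proj_norm n y\<bar> \<le> proj_norm n (x - y)" by (rule proj_norm_diff_le)
    also have "\<dots> \<le> b x" using norm_proj_le_sum[of n "x - y"]
      by (simp add: b_def sum_nonneg flip: ennreal_proj_norm)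
    finally show ?thesis by simp
  qed
  then have "((\<lambda>x. proj_norm n x - proj_norm n y) \<longlongrightarrow> 0) (at y)"
    by (intro Lim_null_comparison[OF _ b]) simp
  then show "(proj_norm n \<longlongrightarrow> proj_norm n y) (at y)" by (rule LIM_zero_cancel)
qed


section \<open>Unconditional convergence\<close>

text \<open>Comparing with \<open>sum u F0\<close> instead of the limit leaves the Cauchy condition,
  the only consequence of convergence used later.\<close>

lemma unconditionally_convergentD:
  assumes conv: "unconditionally_convergent \<Phi> (EXH \<Phi>) u A" and "e > 0"
  obtains F0 where "finite F0" "F0 \<subseteq> A"
    "\<And>F. finite F \<Longrightarrow> F0 \<subseteq> F \<Longrightarrow> F \<subseteq> A \<Longrightarrow> \<Phi> (sum u F - sum u F0) < ennreal e"
proof -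
  obtain s where s: "limitin (norm_topology \<Phi> (EXH \<Phi>)) (sum u) s (finite_subsets_at_top A)"
    using conv unfolding unconditionally_convergent_def by blast
  then have "\<forall>\<^sub>F F in finite_subsets_at_top A. \<Phi> (sum u F - s) < ennreal (e / 2)"
    unfolding limitin_norm_topology_iff[OF EXH_subset_FIN]
    using \<open>e > 0\<close> by (auto elim: eventually_mono dest: spec[of _ "e / 2"])
  then obtain F0 where F0: "finite F0" "F0 \<subseteq> A"
    "\<And>F. finite F \<Longrightarrow> F0 \<subseteq> F \<Longrightarrow> F \<subseteq> A \<Longrightarrow> \<Phi> (sum u F - s) < ennreal (e / 2)"
    unfolding eventually_finite_subsets_at_top by metis
  have "\<Phi> (sum u F - sum u F0) < ennreal e" if "finite F" "F0 \<subseteq> F" "F \<subseteq> A" for F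
  proof -
    have "\<Phi> (sum u F - sum u F0) \<le> \<Phi> (sum u F - s) + \<Phi> (s - sum u F0)" by (rule norm_triangle3)
    also have "\<dots> < ennreal (e / 2) + ennreal (e / 2)"
      using F0 that norm_diff_commute[of s] by (intro add_strict_mono) auto
    also have "\<dots> = ennreal e" using \<open>e > 0\<close> by (simp flip: ennreal_plus)
    finally show ?thesis .
  qed
  then show ?thesis using F0(1,2) that by blast
qed

text \<open>Past \<open>F0\<close> the sums stay within 1 of the sum over \<open>F0\<close>. An
  arbitrary \<open>F\<close> arises from \<open>F \<union> F0\<close> by removing members of
  \<open>F0\<close>, which costs at most their total norm \<open>c\<close>.\<close>

lemma unconditionally_convergent_bounded:
  assumes conv: "unconditionally_convergent \<Phi> (EXH \<Phi>) u A" and u: "u ` A \<subseteq> EXH \<Phi>"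
  obtains n :: nat where "\<And>F. finite F \<Longrightarrow> F \<subseteq> A \<Longrightarrow> \<Phi> (sum u F) \<le> ennreal (real n)"
proof -
  obtain F0 where F0: "finite F0" "F0 \<subseteq> A"
    "\<And>F. finite F \<Longrightarrow> F0 \<subseteq> F \<Longrightarrow> F \<subseteq> A \<Longrightarrow> \<Phi> (sum u F - sum u F0) < ennreal 1"
    using unconditionally_convergentD[OF conv zero_less_one] by metis
  define c where "c = (\<Sum>i\<in>F0. \<Phi> (u i))"
  have "c < \<infinity>"
  proof -
    have "\<Phi> (u i) < \<infinity>" if "i \<in> F0" for i
      using u F0(2) EXH_subset_FIN that unfolding FIN_iff[symmetric] by blast
    then show ?thesis using F0(1) by (simp add: c_def)
  qed
  have *: "\<Phi> (sum u G) \<le> c" if "G \<subseteq> F0" for G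
    unfolding c_def using F0(1) that by (intro order_trans[OF norm_sum] sum_mono2) auto
  have bd: "\<Phi> (sum u F) \<le> 1 + c + c" if "finite F" "F \<subseteq> A" for F
  proof -
    have "sum u (F \<union> F0) = sum u F + sum u (F0 - F)"
      using sum.union_disjoint[of F "F0 - F" u] that F0(1) by (simp add: Un_Diff_cancel)
    then have "sum u F = (sum u (F \<union> F0) - sum u F0) + sum u F0 - sum u (F0 - F)" by simp
    then have "\<Phi> (sum u F) \<le> \<Phi> ((sum u (F \<union> F0) - sum u F0) + sum u F0) + \<Phi> (sum u (F0 - F))"
      by (metis norm_diff_triangle)
    also have "\<dots> \<le> \<Phi> (sum u (F \<union> F0) - sum u F0) + \<Phi> (sum u F0) + \<Phi> (sum u (F0 - F))"
      by (intro add_right_mono norm_triangle)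
    also have "\<dots> \<le> 1 + c + c"
      using that F0 F0(3)[of "F \<union> F0"] by (intro add_mono *) (auto intro: less_imp_le)
    finally show ?thesis .
  qed
  have "1 + c + c < \<infinity>" using \<open>c < \<infinity>\<close> by (simp add: less_top[symmetric])
  then obtain r where r: "1 + c + c = ennreal r" by (cases "1 + c + c") auto
  obtain n :: nat where "r \<le> real n" using real_arch_simple by blast
  then have "ennreal r \<le> ennreal (real n)" by (rule ennreal_leI)
  then show ?thesis using bd that r by (metis order_trans)
qed

text \<open>Bounded coordinate functionals bound the finite subsums of each coordinate; splitting by
  sign turns this into absolute summability.\<close>

lemma bounded_sums_coordinate_summable:
  assumes bd: "\<And>F. finite F \<Longrightarrow> F \<subseteq> A \<Longrightarrow> \<Phi> (sum u F) \<le> ennreal M" and "M \<ge> 0"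
  shows "(\<lambda>n. \<bar>u n i\<bar>) summable_on A"
proof (rule nonneg_bdd_above_summable_on)
  define K where "K = enn2real (\<Phi> (unit_seq i))"
  have "K > 0" unfolding K_def by (rule norm_unit_pos)
  have *: "\<bar>\<Sum>n\<in>F. u n i\<bar> \<le> M / K" if "finite F" "F \<subseteq> A" for F
  proof -
    have "ennreal (\<bar>sum u F i\<bar> * K) \<le> ennreal M"
      using norm_coordinate_le[of "sum u F" i] bd[OF that] unfolding K_def by (rule order_trans)
    then have "\<bar>sum u F i\<bar> * K \<le> M" using \<open>M \<ge> 0\<close> by simp
    then show ?thesis using \<open>K > 0\<close> by (simp add: sum_fun_apply field_simps)
  qed
  show "bdd_above (sum (\<lambda>n. \<bar>u n i\<bar>) ` {F. F \<subseteq> A \<and> finite F})"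
  proof (rule bdd_aboveI2)
    fix F assume F: "F \<in> {F. F \<subseteq> A \<and> finite F}"
    let ?P = "{n\<in>F. u n i \<ge> 0}" and ?N = "{n\<in>F. \<not> u n i \<ge> 0}"
    have "(\<Sum>n\<in>F. \<bar>u n i\<bar>) = (\<Sum>n\<in>?P. \<bar>u n i\<bar>) + (\<Sum>n\<in>?N. \<bar>u n i\<bar>)"
      using F by (subst sum.union_disjoint[symmetric]) (auto intro!: sum.cong)
    also have "(\<Sum>n\<in>?P. \<bar>u n i\<bar>) = (\<Sum>n\<in>?P. u n i)" by (rule sum.cong) auto
    also have "(\<Sum>n\<in>?N. \<bar>u n i\<bar>) = - (\<Sum>n\<in>?N. u n i)"
      unfolding sum_negf[symmetric] by (rule sum.cong) auto
    finally have split: "(\<Sum>n\<in>F. \<bar>u n i\<bar>) = (\<Sum>n\<in>?P. u n i) + - (\<Sum>n\<in>?N. u n i)" .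
    show "(\<Sum>n\<in>F. \<bar>u n i\<bar>) \<le> M / K + M / K"
    proof -
      have "finite ?P" "?P \<subseteq> A" "finite ?N" "?N \<subseteq> A" using F by auto
      then show ?thesis unfolding split
        by (intro add_mono abs_le_D1[OF *[of ?P]] abs_le_D2[OF *[of ?N]])
    qed
  qed
qed auto

text \<open>The left edge of the gliding hump: by absolute summability in each coordinate, sums
  taken far out nearly vanish on the first \<open>m\<close> coordinates.\<close>

lemma bounded_sums_tail:
  assumes bd: "\<And>F. finite F \<Longrightarrow> F \<subseteq> A \<Longrightarrow> \<Phi> (sum u F) \<le> ennreal M" and "M \<ge> 0" and "\<delta> > 0"
  shows "\<exists>F0. finite F0 \<and> F0 \<subseteq> A \<and>
    (\<forall>G. finite G \<and> G \<subseteq> A - F0 \<longrightarrow> \<Phi> (proj_on {..<m} (sum u G)) \<le> ennreal \<delta>)"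
proof -
  define K where "K i = enn2real (\<Phi> (unit_seq i))" for i
  have K: "K i > 0" for i unfolding K_def by (rule norm_unit_pos)
  have coord: "\<exists>F0. finite F0 \<and> F0 \<subseteq> A \<and> (\<forall>G. finite G \<and> G \<subseteq> A - F0 \<longrightarrow> \<bar>sum u G i\<bar> \<le> \<eta>)"
    if "\<eta> > 0" for i \<eta>
  proof -
    let ?f = "\<lambda>n. \<bar>u n i\<bar>"
    have sm: "?f summable_on A" by (rule bounded_sums_coordinate_summable[OF bd \<open>M \<ge> 0\<close>])
    then have "(sum ?f \<longlongrightarrow> infsum ?f A) (finite_subsets_at_top A)" by (rule infsum_tendsto)
    then have "\<forall>\<^sub>F F in finite_subsets_at_top A. infsum ?f A - \<eta> < sum ?f F"
      by (rule order_tendstoD) (use that in simp)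
    then obtain F0 where F0: "finite F0" "F0 \<subseteq> A" "infsum ?f A - \<eta> < sum ?f F0"
      unfolding eventually_finite_subsets_at_top by blast
    have "\<bar>sum u G i\<bar> \<le> \<eta>" if G: "finite G" "G \<subseteq> A - F0" for G
    proof -
      have "sum ?f F0 + sum ?f G = sum ?f (F0 \<union> G)"
        using F0(1) G by (subst sum.union_disjoint) auto
      also have "\<dots> \<le> infsum ?f A" using F0 G sm by (intro finite_sum_le_infsum) auto
      finally have "sum ?f G \<le> \<eta>" using F0(3) by simp
      then show ?thesis unfolding sum_fun_apply by (rule order_trans[OF sum_abs])
    qed
    then show ?thesis using F0 by blast
  qed
  \<comment> \<open>Scaled so that \<open>m\<close> weighted coordinates add up to at most
    \<open>\<delta>\<close>; \<open>Suc m\<close> avoids division by 0.\<close>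
  define \<eta> where "\<eta> i = \<delta> / (real (Suc m) * K i)" for i
  have "\<eta> i > 0" for i using K \<open>\<delta> > 0\<close> by (simp add: \<eta>_def)
  then have "\<forall>i. \<exists>F0. finite F0 \<and> F0 \<subseteq> A \<and> (\<forall>G. finite G \<and> G \<subseteq> A - F0 \<longrightarrow> \<bar>sum u G i\<bar> \<le> \<eta> i)"
    using coord by blast
  then obtain F0 where "\<forall>i. finite (F0 i) \<and> F0 i \<subseteq> A \<and>
      (\<forall>G. finite G \<and> G \<subseteq> A - F0 i \<longrightarrow> \<bar>sum u G i\<bar> \<le> \<eta> i)"
    by (rule choice[THEN exE])
  then have F0: "\<And>i. finite (F0 i)" "\<And>i. F0 i \<subseteq> A"
    "\<And>i G. finite G \<Longrightarrow> G \<subseteq> A - F0 i \<Longrightarrow> \<bar>sum u G i\<bar> \<le> \<eta> i"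
    by blast+
  show ?thesis
  proof (intro exI[of _ "\<Union>i<m. F0 i"] conjI allI impI)
    show "finite (\<Union>i<m. F0 i)" "(\<Union>i<m. F0 i) \<subseteq> A" using F0 by auto
    fix G assume G: "finite G \<and> G \<subseteq> A - (\<Union>i<m. F0 i)"
    have "\<Phi> (proj_on {..<m} (sum u G)) \<le> ennreal (\<Sum>i<m. \<bar>sum u G i\<bar> * K i)"
      unfolding K_def by (rule norm_proj_le_sum)
    also have "\<dots> \<le> ennreal \<delta>"
    proof (rule ennreal_leI)
      have "(\<Sum>i<m. \<bar>sum u G i\<bar> * K i) \<le> (\<Sum>i<m. \<eta> i * K i)"
      proof (rule sum_mono)
        fix i assume "i \<in> {..<m}"
        then have "\<bar>sum u G i\<bar> \<le> \<eta> i" using G by (intro F0(3)) auto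
        then show "\<bar>sum u G i\<bar> * K i \<le> \<eta> i * K i" using K[of i] by (simp add: mult_right_mono)
      qed
      also have "\<dots> = (\<Sum>i<m. \<delta> / real (Suc m))"
        using K by (intro sum.cong) (auto simp: \<eta>_def less_imp_neq[symmetric])
      also have "\<dots> \<le> \<delta>" using \<open>\<delta> > 0\<close> by (simp add: field_simps)
      finally show "(\<Sum>i<m. \<bar>sum u G i\<bar> * K i) \<le> \<delta>" .
    qed
    finally show "\<Phi> (proj_on {..<m} (sum u G)) \<le> ennreal \<delta>" .
  qed
qed

text \<open>Gliding hump: were the finite subsums not Cauchy, disjoint blocks of large subsums could be
  cut to successive intervals of coordinates, gluing to an element of \<open>FIN - EXH\<close>.\<close>

lemma bounded_sums_Cauchy:
  assumes eq: "FIN \<Phi> = EXH \<Phi>" and u: "u ` A \<subseteq> EXH \<Phi>"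
    and bd: "\<And>F. finite F \<Longrightarrow> F \<subseteq> A \<Longrightarrow> \<Phi> (sum u F) \<le> ennreal M" and "M \<ge> 0" and "e > 0"
  shows "\<exists>F0. finite F0 \<and> F0 \<subseteq> A \<and> (\<forall>G. finite G \<and> G \<subseteq> A - F0 \<longrightarrow> \<Phi> (sum u G) \<le> ennreal e)"
proof (rule ccontr)
  assume "\<not> ?thesis"
  then have neg: "\<forall>F0. finite F0 \<and> F0 \<subseteq> A \<longrightarrow> (\<exists>G. finite G \<and> G \<subseteq> A - F0 \<and> ennreal e < \<Phi> (sum u G))"
    by (meson not_le)
  have step: "\<exists>m' G. m < m' \<and> finite G \<and> G \<subseteq> A - F \<and> ennreal e < \<Phi> (sum u G) \<and>
      \<Phi> (sum u G - proj_on {m..<m'} (sum u G)) \<le> ennreal (e * (1 / 2) ^ (k + 2))"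
    if F: "finite F" "F \<subseteq> A" for k m F
  proof -
    \<comment> \<open>The two edges of a hump cost \<open>\<delta>\<close> each. Each hump then has
      error at most \<open>e / 4\<close>, and all errors together at most
      \<open>e / 2\<close>.\<close>
    define \<delta> where "\<delta> = e * (1 / 2) ^ (k + 3)"
    have "\<delta> > 0" using \<open>e > 0\<close> by (simp add: \<delta>_def)
    obtain F0 where F0: "finite F0" "F0 \<subseteq> A"
      "\<And>G. finite G \<Longrightarrow> G \<subseteq> A - F0 \<Longrightarrow> \<Phi> (proj_on {..<m} (sum u G)) \<le> ennreal \<delta>"
      using bounded_sums_tail[of A u M \<delta> m, OF bd \<open>M \<ge> 0\<close> \<open>\<delta> > 0\<close>] by metis
    have "finite (F \<union> F0)" "F \<union> F0 \<subseteq> A" using F F0(1,2) by auto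
    then obtain G where G: "finite G" "G \<subseteq> A - (F \<union> F0)" "ennreal e < \<Phi> (sum u G)"
      using neg by meson
    let ?v = "sum u G"
    have "?v \<in> EXH \<Phi>" using u G(2) by (intro EXH_sum) auto
    then obtain m1 where m1: "\<Phi> (proj_on (- {..<m1}) ?v) < ennreal \<delta>"
      using \<open>\<delta> > 0\<close> EXH_iff by blast
    define m' where "m' = max (Suc m) m1"
    have "?v - proj_on {m..<m'} ?v = proj_on {..<m} ?v + proj_on (- {..<m'}) ?v"
      by (auto simp: proj_on_def fun_eq_iff m'_def)
    then have "\<Phi> (?v - proj_on {m..<m'} ?v) \<le> \<Phi> (proj_on {..<m} ?v) + \<Phi> (proj_on (- {..<m'}) ?v)"
      by (metis norm_triangle)
    also have "\<dots> \<le> ennreal \<delta> + \<Phi> (proj_on (- {..<m1}) ?v)"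
      using G by (intro add_mono F0(3) norm_proj_mono) (auto simp: m'_def)
    also have "\<dots> \<le> ennreal \<delta> + ennreal \<delta>" using m1 by (intro add_left_mono less_imp_le)
    also have "\<dots> = ennreal (e * (1 / 2) ^ (k + 2))"
    proof -
      have "\<delta> + \<delta> = e * (1 / 2) ^ (k + 2)" by (simp add: \<delta>_def power_add power2_eq_square power3_eq_cube)
      then show ?thesis using \<open>\<delta> > 0\<close> by (simp flip: ennreal_plus)
    qed
    finally show ?thesis using G
      by (intro exI[of _ m'] exI[of _ G]) (auto simp: m'_def)
  qed
  \<comment> \<open>The choice is made by total functions of the state, since a step exists only for
    finite \<open>F \<subseteq> A\<close>.\<close>
  define R where "R k m F p \<longleftrightarrow> m < fst p \<and> finite (snd p) \<and> snd p \<subseteq> A - F \<and> ennreal e < \<Phi> (sum u (snd p)) \<and>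
      \<Phi> (sum u (snd p) - proj_on {m..<fst p} (sum u (snd p))) \<le> ennreal (e * (1 / 2) ^ (k + 2))" for k m F p
  define mm where "mm k m F = fst (SOME p. R k m F p)" for k m F
  define GG where "GG k m F = snd (SOME p. R k m F p)" for k m F
  have mG: "m < mm k m F \<and> finite (GG k m F) \<and>
      GG k m F \<subseteq> A - F \<and> ennreal e < \<Phi> (sum u (GG k m F)) \<and>
      \<Phi> (sum u (GG k m F) - proj_on {m..<mm k m F} (sum u (GG k m F))) \<le> ennreal (e * (1 / 2) ^ (k + 2))"
    if "finite F" "F \<subseteq> A" for k m F
  proof -
    have "\<exists>p. R k m F p" using step[OF that, of m k] unfolding R_def by (metis fst_conv snd_conv)
    then have "R k m F (SOME p. R k m F p)" by (rule someI_ex)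
    then show ?thesis unfolding R_def mm_def GG_def .
  qed
  \<comment> \<open>The state is the next cut point and the set of indices already used, so that the
    sets \<open>G k\<close> are disjoint.\<close>
  define st where "st = rec_nat (0, {}) (\<lambda>k (m, F). (mm k m F, F \<union> GG k m F))"
  define a where "a k = fst (st k)" for k
  define F where "F k = snd (st k)" for k
  define G where "G k = GG k (a k) (F k)" for k
  have st: "a 0 = 0" "F 0 = {}" "a (Suc k) = mm k (a k) (F k)" "F (Suc k) = F k \<union> G k" for k
    by (simp_all add: a_def F_def G_def st_def split_beta)
  have F: "finite (F k) \<and> F k \<subseteq> A" for k
    by (induction k) (use mG in \<open>auto simp: st G_def\<close>)
  have mG': "a k < a (Suc k) \<and> finite (G k) \<and> G k \<subseteq> A - F k \<and> ennreal e < \<Phi> (sum u (G k)) \<and>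
      \<Phi> (sum u (G k) - proj_on {a k..<a (Suc k)} (sum u (G k))) \<le> ennreal (e * (1 / 2) ^ (k + 2))" for k
    unfolding st(3) G_def by (rule mG[OF F[THEN conjunct1] F[THEN conjunct2]])
  define v where "v k = sum u (G k)" for k
  have mono: "strict_mono a" using mG' by (simp add: strict_mono_Suc_iff)
  define \<kappa> where "\<kappa> i = (LEAST k. i < a (Suc k))" for i
  \<comment> \<open>Glues the humps: on block \<open>k\<close>, \<open>w\<close> is a copy of
    \<open>v k\<close>.\<close>
  define w where "w i = v (\<kappa> i) i" for i
  have w: "proj_on {a k..<a (Suc k)} w = proj_on {a k..<a (Suc k)} (v k)" for k
    using block_index_unique[OF mono] by (auto simp: proj_on_def w_def \<kappa>_def fun_eq_iff)
  have err: "\<Phi> (v k - proj_on {a k..<a (Suc k)} w) \<le> ennreal (e * (1 / 2) ^ (k + 2))" for k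
    unfolding w v_def using mG'[of k] by blast
  have big: "ennreal (e / 2) \<le> \<Phi> (proj_on {a k..<a (Suc k)} w)" for k
  proof (rule ccontr)
    assume "\<not> ?thesis"
    then have lt: "\<Phi> (proj_on {a k..<a (Suc k)} w) < ennreal (e / 2)" by simp
    have "\<Phi> (v k) \<le> \<Phi> (v k - proj_on {a k..<a (Suc k)} w) + \<Phi> (proj_on {a k..<a (Suc k)} w)"
      by (rule norm_le_diff)
    also have "\<dots> \<le> ennreal (e * (1 / 2) ^ (k + 2)) + ennreal (e / 2)"
      using err lt by (intro add_mono) auto
    also have "\<dots> = ennreal (e * (1 / 2) ^ (k + 2) + e / 2)" using \<open>e > 0\<close> by (simp add: ennreal_plus)
    also have "\<dots> \<le> ennreal e"
    proof (rule ennreal_leI)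
      have "(1 / 2 :: real) ^ (k + 2) \<le> 1 / 4" using power_le_one[of "1 / 2 :: real" k] by simp
      then show "e * (1 / 2) ^ (k + 2) + e / 2 \<le> e"
        using mult_left_mono[of "(1 / 2 :: real) ^ (k + 2)" "1 / 4" e] \<open>e > 0\<close> by linarith
    qed
    finally show False using mG'[of k] unfolding v_def by (meson leD)
  qed
  have sumF: "sum u (F N) = (\<Sum>k<N. v k)" for N
  proof (induction N)
    case (Suc N)
    have "sum u (F (Suc N)) = sum u (F N) + sum u (G N)"
      unfolding st(4) using F mG'[of N] by (intro sum.union_disjoint) auto
    then show ?case by (simp only: Suc v_def sum.lessThan_Suc)
  qed (simp add: st)
  have projN: "proj_on {..<a N} w = (\<Sum>k<N. proj_on {a k..<a (Suc k)} w)" for N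
  proof (induction N)
    case 0
    then show ?case by (auto simp: st(1) proj_on_def)
  next
    case (Suc N)
    have "a N < a (Suc N)" using mono by (simp add: strict_mono_Suc_iff)
    then have "proj_on {..<a (Suc N)} w = proj_on {..<a N} w + proj_on {a N..<a (Suc N)} w"
      by (auto simp: proj_on_def fun_eq_iff)
    then show ?case by (simp only: Suc sum.lessThan_Suc)
  qed
  \<comment> \<open>Truncated at a cut point, \<open>w\<close> is a finite subsum of the family up
    to the total error. So \<open>w\<close> has finite norm although each of its blocks has norm at
    least \<open>e / 2\<close>.\<close>
  have bdN: "\<Phi> (proj_on {..<a N} w) \<le> ennreal (M + e)" for N
  proof -
    have "proj_on {..<a N} w = sum u (F N) - (\<Sum>k<N. v k - proj_on {a k..<a (Suc k)} w)"
      by (simp only: projN sumF sum_subtractf) simp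
    then have "\<Phi> (proj_on {..<a N} w) \<le> \<Phi> (sum u (F N)) + \<Phi> (\<Sum>k<N. v k - proj_on {a k..<a (Suc k)} w)"
      by (metis norm_diff_triangle)
    also have "\<dots> \<le> ennreal M + (\<Sum>k<N. ennreal (e * (1 / 2) ^ (k + 2)))"
      using F by (intro add_mono bd order_trans[OF norm_sum] sum_mono err) auto
    also have "\<dots> = ennreal (M + (\<Sum>k<N. e * (1 / 2) ^ (k + 2)))"
      using \<open>e > 0\<close> \<open>M \<ge> 0\<close> by (subst sum_ennreal) (auto simp: ennreal_plus sum_nonneg)
    also have "\<dots> \<le> ennreal (M + e)"
    proof (intro ennreal_leI add_left_mono)
      have "(\<Sum>k<N. e * (1 / 2) ^ (k + 2)) = e / 4 * (\<Sum>k<N. (1 / 2) ^ k)"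
        by (simp add: sum_distrib_left)
      also have "\<dots> \<le> e / 4 * 2"
        using \<open>e > 0\<close> by (intro mult_left_mono) (auto simp: geometric_sum)
      also have "\<dots> \<le> e" using \<open>e > 0\<close> by simp
      finally show "(\<Sum>k<N. e * (1 / 2) ^ (k + 2)) \<le> e" .
    qed
    finally show ?thesis .
  qed
  have "\<Phi> w \<le> ennreal (M + e)"
  proof (rule norm_leI)
    fix n
    have "n \<le> a n" using mono by (rule strict_mono_imp_increasing)
    then have "{..<n} \<subseteq> {..<a n}" by simp
    from norm_proj_mono[OF this] bdN[of n]
    show "\<Phi> (proj_on {..<n} w) \<le> ennreal (M + e)" by (rule order_trans)
  qed
  then have "w \<in> FIN \<Phi>" unfolding FIN_iff by (rule le_less_trans) simp
  then obtain n where n: "\<Phi> (proj_on (- {..<n}) w) < ennreal (e / 2)"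
    unfolding eq EXH_iff using \<open>e > 0\<close> half_gt_zero by blast
  have "n \<le> a n" using mono by (rule strict_mono_imp_increasing)
  then have "\<Phi> (proj_on {a n..<a (Suc n)} w) \<le> \<Phi> (proj_on (- {..<n}) w)"
    by (intro norm_proj_mono) auto
  then show False using big[of n] n by (meson leD order_trans)
qed

text \<open>The limit \<open>s\<close> is formed coordinatewise, and the Cauchy condition gives
  convergence in norm. It lies in \<open>EXH \<Phi>\<close> because it is at finite distance from a
  finite subsum and \<open>FIN \<Phi> = EXH \<Phi>\<close>.\<close>

lemma bounded_sums_unconditionally_convergent:
  assumes eq: "FIN \<Phi> = EXH \<Phi>" and u: "u ` A \<subseteq> EXH \<Phi>"
    and bd: "\<And>F. finite F \<Longrightarrow> F \<subseteq> A \<Longrightarrow> \<Phi> (sum u F) \<le> ennreal M" and "M \<ge> 0"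
  shows "unconditionally_convergent \<Phi> (EXH \<Phi>) u A"
proof -
  define K where "K i = enn2real (\<Phi> (unit_seq i))" for i
  define s where "s i = infsum (\<lambda>n. u n i) A" for i
  have lim: "((\<lambda>G. sum u G i) \<longlongrightarrow> s i) (finite_subsets_at_top A)" for i
  proof -
    have "(\<lambda>n. \<bar>u n i\<bar>) summable_on A" by (rule bounded_sums_coordinate_summable[OF bd \<open>M \<ge> 0\<close>])
    then have "(\<lambda>n. u n i) summable_on A"
      using abs_summable_summable[of "\<lambda>n. u n i" A] by simp
    then show ?thesis unfolding s_def sum_fun_apply by (rule infsum_tendsto)
  qed
  \<comment> \<open>For \<open>G\<close> past \<open>F\<close>, each truncated distance is at most
    \<open>e\<close> plus an error \<open>b G\<close> that tends to 0 along the finite subsets of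
    \<open>A\<close>.\<close>
  have near: "\<Phi> (sum u F - s) \<le> ennreal e"
    if F0: "\<forall>G. finite G \<and> G \<subseteq> A - F0 \<longrightarrow> \<Phi> (sum u G) \<le> ennreal e"
      and F: "finite F" "F0 \<subseteq> F" "F \<subseteq> A" and "e > 0" for e F F0
  proof (rule norm_leI)
    fix m
    define b where "b G = (\<Sum>i<m. \<bar>(sum u G - s) i\<bar> * K i)" for G
    have "(b \<longlongrightarrow> (\<Sum>i<m. \<bar>s i - s i\<bar> * K i)) (finite_subsets_at_top A)"
      unfolding b_def minus_apply by (intro tendsto_intros lim)
    then have "((\<lambda>G. e + b G) \<longlongrightarrow> e + 0) (finite_subsets_at_top A)"
      by (intro tendsto_intros) simp
    moreover have "\<forall>\<^sub>F G in finite_subsets_at_top A. proj_norm m (sum u F - s) \<le> e + b G"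
      unfolding eventually_finite_subsets_at_top
    proof (intro exI[of _ F] conjI allI impI)
      fix G assume G: "finite G \<and> F \<subseteq> G \<and> G \<subseteq> A"
      have "b G \<ge> 0" unfolding b_def K_def by (intro sum_nonneg) auto
      have "sum u G = sum u F + sum u (G - F)" using G F(1) sum.subset_diff[of F G u] by (simp add: add.commute)
      then have "sum u F - sum u G = 0 - sum u (G - F)" by simp
      then have "\<Phi> (sum u F - sum u G) = \<Phi> (sum u (G - F))" by (metis norm_diff_commute diff_zero)
      also have "\<dots> \<le> ennreal e" using F0 G F by (metis Diff_mono finite_Diff)
      finally have 1: "\<Phi> (sum u F - sum u G) \<le> ennreal e" .
      have "ennreal (proj_norm m (sum u F - s)) \<le> \<Phi> (proj_on {..<m} (sum u F) - proj_on {..<m} (sum u G))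
          + \<Phi> (proj_on {..<m} (sum u G) - proj_on {..<m} s)"
        unfolding ennreal_proj_norm proj_on_diff by (rule norm_triangle3)
      also have "\<dots> \<le> ennreal e + ennreal (b G)"
        unfolding proj_on_diff[symmetric] b_def K_def
        by (intro add_mono norm_proj_le_sum order_trans[OF norm_proj_le 1])
      also have "\<dots> = ennreal (e + b G)" using \<open>e > 0\<close> \<open>b G \<ge> 0\<close> by (simp add: ennreal_plus)
      finally show "proj_norm m (sum u F - s) \<le> e + b G"
        using \<open>e > 0\<close> \<open>b G \<ge> 0\<close> by (subst (asm) ennreal_le_iff) auto
    qed (use F in auto)
    ultimately have "proj_norm m (sum u F - s) \<le> e + 0"
      by (rule tendsto_lowerbound) simp
    then show "\<Phi> (proj_on {..<m} (sum u F - s)) \<le> ennreal e"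
      unfolding ennreal_proj_norm[symmetric] by (intro ennreal_leI) simp
  qed
  note Cauchy = bounded_sums_Cauchy[OF eq u bd \<open>M \<ge> 0\<close>]
  have inE: "sum u F \<in> EXH \<Phi>" if "F \<subseteq> A" for F using u that by (intro EXH_sum) auto
  obtain F1 where F1: "finite F1" "F1 \<subseteq> A"
    "\<forall>G. finite G \<and> G \<subseteq> A - F1 \<longrightarrow> \<Phi> (sum u G) \<le> ennreal 1"
    using Cauchy[of 1] by auto
  have "\<Phi> (sum u F1 - s) \<le> ennreal 1" using near[OF F1(3,1) _ F1(2)] by simp
  then have "sum u F1 - s \<in> EXH \<Phi>" unfolding eq[symmetric] FIN_iff by (rule le_less_trans) simp
  then have "sum u F1 - (sum u F1 - s) \<in> EXH \<Phi>" using inE[OF F1(2)] EXH_diff by blast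
  then have s: "s \<in> EXH \<Phi>" by simp
  show ?thesis
    unfolding unconditionally_convergent_def limitin_norm_topology_iff[OF EXH_subset_FIN]
  proof (intro exI[of _ s] conjI s allI impI)
    fix e :: real assume "e > 0"
    then obtain F0 where F0: "finite F0" "F0 \<subseteq> A"
      "\<forall>G. finite G \<and> G \<subseteq> A - F0 \<longrightarrow> \<Phi> (sum u G) \<le> ennreal (e / 2)"
      using Cauchy[of "e / 2"] by auto
    have "sum u F \<in> EXH \<Phi> \<and> \<Phi> (sum u F - s) < ennreal e" if "finite F \<and> F0 \<subseteq> F \<and> F \<subseteq> A" for F
    proof -
      have "\<Phi> (sum u F - s) \<le> ennreal (e / 2)"
        using near[OF F0(3)] that \<open>e > 0\<close> by simp
      also have "\<dots> < ennreal e" using \<open>e > 0\<close> by (intro ennreal_lessI) auto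
      finally show ?thesis using inE that by blast
    qed
    then show "\<forall>\<^sub>F F in finite_subsets_at_top A. sum u F \<in> EXH \<Phi> \<and> \<Phi> (sum u F - s) < ennreal e"
      unfolding eventually_finite_subsets_at_top using F0(1,2) by blast
  qed
qed

end


section \<open>The ideal \<open>\<emptyset> \<times> Fin\<close> and the density zero ideal\<close>

lemma fsigma_in_euclidean_UN:
  assumes "\<And>n::nat. closed (C n)"
  shows "fsigma_in euclidean (\<Union>n. C n)"
proof (rule fsigma_in_Union)
  show "countable (range C)" by simp
  show "fsigma_in euclidean S" if "S \<in> range C" for S
    using that assms by (auto intro!: closed_imp_fsigma_in)
qed

lemma fsigma_in_euclideanD:
  assumes "fsigma_in euclidean S"
  obtains C :: "nat \<Rightarrow> _" where "\<And>n. closed (C n)" "S = (\<Union>n. C n)"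
  using assms unfolding fsigma_in_ascending closed_closedin[symmetric] by auto

text \<open>For fixed \<open>F\<close>, failure of \<open>F \<subseteq> \<theta> z\<close> is a
  finite union of closed conditions; these are intersected over the \<open>F\<close> that violate
  \<open>P\<close>. The map \<open>\<theta>\<close> will be \<open>Collect\<close> for representable
  ideals and \<open>dyadic_code\<close> for the density zero ideal.\<close>

lemma closed_bounded_subsets:
  fixes \<theta> :: "(nat \<Rightarrow> bool) \<Rightarrow> nat set"
  assumes "\<And>j. closed {z. j \<notin> \<theta> z}"
  shows "closed {z. \<forall>F. finite F \<and> F \<subseteq> \<theta> z \<longrightarrow> P F}"
proof -
  have "closed (\<Inter>F\<in>{F. finite F \<and> \<not> P F}. \<Union>j\<in>F. {z. j \<notin> \<theta> z})"
    using assms by (intro closed_INT ballI closed_UN) auto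
  also have "(\<Inter>F\<in>{F. finite F \<and> \<not> P F}. \<Union>j\<in>F. {z. j \<notin> \<theta> z}) = {z. \<forall>F. finite F \<and> F \<subseteq> \<theta> z \<longrightarrow> P F}"
    by auto
  finally show ?thesis .
qed

lemma closed_coordinate_False: "closed {z :: nat \<Rightarrow> bool. \<not> z i}"
proof -
  have "closed ((\<lambda>z :: nat \<Rightarrow> bool. z i) -` {False})"
    by (intro closed_vimage closed_singleton continuous_on_product_coordinates)
  also have "(\<lambda>z :: nat \<Rightarrow> bool. z i) -` {False} = {z. \<not> z i}" by auto
  finally show ?thesis .
qed

lemma fin_rows_not_fsigma: "\<not> fsigma_in euclidean fin_rows"
proof
  assume "fsigma_in euclidean fin_rows"
  then obtain C :: "nat \<Rightarrow> _" where C: "\<And>n. closed (C n)" "fin_rows = (\<Union>n. C n)"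
    by (rule fsigma_in_euclideanD) (rule that)
  obtain n z where "z \<in> C n" "z \<notin> fin_rows"
    by (rule fin_rows_closed_cover[of C]) (use C in auto)
  then show False using C(2) by blast
qed

definition row_weight :: "(nat \<Rightarrow> bool) \<Rightarrow> rseq" where
  "row_weight z k = (if z k then (1 / 2) ^ row k else 0)"

lemma row_weight_c0_iff: "row_weight z \<in> c0 \<longleftrightarrow> z \<in> fin_rows"
proof
  assume "row_weight z \<in> c0"
  then have lim: "row_weight z \<longlonglongrightarrow> 0" by (simp add: c0_def)
  have "finite {i. z i \<and> row i = m}" for m
  proof -
    have "\<forall>\<^sub>F k in sequentially. row_weight z k < (1 / 2) ^ m"
      by (rule order_tendstoD(2)[OF lim]) simp
    then obtain N where N: "\<And>k. k \<ge> N \<Longrightarrow> row_weight z k < (1 / 2) ^ m"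
      unfolding eventually_sequentially by blast
    have "{i. z i \<and> row i = m} \<subseteq> {..<N}"
      using N by (force simp: row_weight_def not_less[symmetric])
    then show ?thesis using finite_subset by blast
  qed
  then show "z \<in> fin_rows" by (simp add: fin_rows_def)
next
  assume z: "z \<in> fin_rows"
  have "row_weight z \<longlonglongrightarrow> 0"
  proof (rule LIMSEQ_I)
    fix e :: real assume "e > 0"
    then obtain m where m: "(1 / 2 :: real) ^ m < e"
      using real_arch_pow_inv[of e "1 / 2"] by auto
    have "finite (\<Union>r<m. {i. z i \<and> row i = r})" using z by (auto simp: fin_rows_def)
    then obtain N where N: "\<forall>i\<in>(\<Union>r<m. {i. z i \<and> row i = r}). i < N"
      using finite_nat_set_iff_bounded by blast
    have "norm (row_weight z k - 0) < e" if "k \<ge> N" for k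
    proof (cases "z k")
      case True
      then have "row k \<ge> m" using N that by fastforce
      then have "(1 / 2 :: real) ^ row k \<le> (1 / 2) ^ m" by (intro power_decreasing) auto
      from this m have "(1 / 2 :: real) ^ row k < e" by (rule le_less_trans)
      then show ?thesis using True by (simp add: row_weight_def)
    qed (use \<open>e > 0\<close> in \<open>simp add: row_weight_def\<close>)
    then show "\<exists>N. \<forall>k\<ge>N. norm (row_weight z k - 0) < e" by blast
  qed
  then show "row_weight z \<in> c0" by (simp add: c0_def)
qed

text \<open>Lets the reduction of sets serve for equivalence relations: in absolute value, a
  difference of weights is the weight of the symmetric difference.\<close>

lemma row_weight_diff_c0_iff:
  "row_weight z - row_weight z' \<in> c0 \<longleftrightarrow> (\<lambda>i. z i \<noteq> z' i) \<in> fin_rows"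
proof -
  have "\<bar>(row_weight z - row_weight z') k\<bar> = row_weight (\<lambda>i. z i \<noteq> z' i) k" for k
    by (simp add: row_weight_def)
  then have "row_weight z - row_weight z' \<in> c0 \<longleftrightarrow> row_weight (\<lambda>i. z i \<noteq> z' i) \<in> c0"
    unfolding c0_def mem_Collect_eq
    by (subst tendsto_rabs_zero_iff[symmetric]) (simp del: minus_apply)
  then show ?thesis by (simp add: row_weight_c0_iff)
qed

lemma continuous_on_row_weight: "continuous_on UNIV row_weight"
proof (rule continuous_on_coordinatewise_then_product)
  fix k
  have "continuous_on UNIV ((\<lambda>b. if b then (1 / 2) ^ row k else 0 :: real) \<circ> (\<lambda>z :: nat \<Rightarrow> bool. z k))"
    by (intro continuous_on_compose continuous_on_product_coordinates) simp
  then show "continuous_on UNIV (\<lambda>z. row_weight z k)" by (simp add: row_weight_def o_def)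
qed

text \<open>\<open>floor_log i = k\<close> marks the dyadic interval from \<open>2^k\<close> to
  \<open>2^(k+1) - 1\<close>, except that \<open>floor_log 0 = 0\<close>; hence the assumption
  \<open>0 \<notin> A\<close> below.\<close>

definition dyadic_density :: "nat set \<Rightarrow> rseq" where
  "dyadic_density A k = real (card {i \<in> A. floor_log i = k}) / 2 ^ k"

lemma floor_log_eq_iff:
  assumes "i > 0"
  shows "floor_log i = k \<longleftrightarrow> 2 ^ k \<le> i \<and> i < 2 ^ Suc k"
proof
  show "floor_log i = k \<Longrightarrow> 2 ^ k \<le> i \<and> i < 2 ^ Suc k"
    using floor_log_exp2_le[OF assms] floor_log_exp2_gt[of i] by auto
  show "floor_log i = k" if "2 ^ k \<le> i \<and> i < 2 ^ Suc k"
    by (rule floor_log_eqI) (use that in auto)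
qed

lemma finite_floor_log_fibre: "0 \<notin> A \<Longrightarrow> finite {i \<in> A. floor_log i = k}"
  by (rule finite_subset[of _ "{..<2 ^ Suc k}"]) (auto, metis floor_log_eq_iff neq0_conv power_Suc)

text \<open>A dyadic interval has half the length of the initial segment taken at its end, so its
  density is at most twice that of the segment. Conversely, small densities on late intervals add up
  geometrically, and the early intervals become negligible.\<close>

lemma Z_ideal_iff:
  assumes "0 \<notin> A"
  shows "A \<in> Z_ideal \<longleftrightarrow> dyadic_density A \<in> c0"
proof -
  have A0: "i > 0" if "i \<in> A" for i using assms that by (cases i) auto
  show ?thesis
  proof
    assume "A \<in> Z_ideal"
    then have "(\<lambda>n. real (card (A \<inter> {1..n})) / real n) \<longlonglongrightarrow> 0" by (simp add: Z_ideal_def)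
    moreover have "filterlim (\<lambda>k. 2 ^ Suc k :: nat) at_top sequentially"
      by (rule filterlim_subseq) (simp add: strict_mono_Suc_iff)
    ultimately have "(\<lambda>k. real (card (A \<inter> {1..2 ^ Suc k})) / real (2 ^ Suc k)) \<longlonglongrightarrow> 0"
      by (rule filterlim_compose)
    then have lim: "(\<lambda>k. 2 * (real (card (A \<inter> {1..2 ^ Suc k})) / real (2 ^ Suc k))) \<longlonglongrightarrow> 0"
      by (rule tendsto_mult_right_zero)
    have "norm (dyadic_density A k) \<le> 2 * (real (card (A \<inter> {1..2 ^ Suc k})) / real (2 ^ Suc k))" for k
    proof -
      have "card {i \<in> A. floor_log i = k} \<le> card (A \<inter> {1..2 ^ Suc k})"
        using A0 by (intro card_mono) (auto simp: Suc_le_eq floor_log_exp2_ge)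
      then show ?thesis by (simp add: dyadic_density_def field_simps)
    qed
    then have "dyadic_density A \<longlonglongrightarrow> 0"
      by (intro Lim_null_comparison[OF _ lim]) simp
    then show "dyadic_density A \<in> c0" by (simp add: c0_def)
  next
    assume "dyadic_density A \<in> c0"
    then have lim: "dyadic_density A \<longlonglongrightarrow> 0" by (simp add: c0_def)
    have "(\<lambda>n. real (card (A \<inter> {1..n})) / real n) \<longlonglongrightarrow> 0"
    proof (rule LIMSEQ_I)
      fix e :: real assume "e > 0"
      \<comment> \<open>\<open>e / 4\<close>, since \<open>n\<close> may be as small as half of the
        power \<open>2 ^ ?L\<close> bounding it below, and another \<open>e / 2\<close> is reserved
        for the intervals before \<open>K\<close>.\<close>
      have "\<forall>\<^sub>F k in sequentially. dyadic_density A k < e / 4"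
        by (rule order_tendstoD(2)[OF lim]) (use \<open>e > 0\<close> in simp)
      then obtain K where K: "\<And>k. k \<ge> K \<Longrightarrow> dyadic_density A k < e / 4"
        unfolding eventually_sequentially by blast
      \<comment> \<open>The first \<open>K\<close> intervals are counted in full by
        \<open>2 ^ K\<close>; each later one adds at most \<open>e / 4 * 2 ^ L\<close>, just what
        doubling \<open>2 ^ L\<close> allows.\<close>
      have bound: "real (card (A \<inter> {1..<2 ^ L})) \<le> 2 ^ K + e / 4 * 2 ^ L" for L
      proof (induction L)
        case (Suc L)
        show ?case
        proof (cases "L < K")
          case True
          have "card (A \<inter> {1..<2 ^ Suc L}) \<le> card {1..<2 ^ Suc L :: nat}" by (intro card_mono) auto
          also have "\<dots> \<le> 2 ^ Suc L" by simp
          also have "\<dots> \<le> 2 ^ K" using True by (intro power_increasing) auto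
          finally have "real (card (A \<inter> {1..<2 ^ Suc L})) \<le> real (2 ^ K)" by (rule of_nat_mono)
          moreover have "0 \<le> e / 4 * 2 ^ Suc L" using \<open>e > 0\<close> by simp
          ultimately show ?thesis by (simp only: of_nat_power of_nat_numeral)
        next
          case False
          have "A \<inter> {1..<2 ^ Suc L} \<subseteq> (A \<inter> {1..<2 ^ L}) \<union> {i \<in> A. floor_log i = L}"
            using A0 by (auto simp: floor_log_eq_iff)
          then have "card (A \<inter> {1..<2 ^ Suc L}) \<le> card ((A \<inter> {1..<2 ^ L}) \<union> {i \<in> A. floor_log i = L})"
            using finite_floor_log_fibre[OF assms] by (intro card_mono) auto
          also have "\<dots> \<le> card (A \<inter> {1..<2 ^ L}) + card {i \<in> A. floor_log i = L}" by (rule card_Un_le)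
          finally have "real (card (A \<inter> {1..<2 ^ Suc L}))
            \<le> real (card (A \<inter> {1..<2 ^ L})) + real (card {i \<in> A. floor_log i = L})"
            unfolding of_nat_add[symmetric] by (rule of_nat_mono)
          moreover have "real (card {i \<in> A. floor_log i = L}) \<le> e / 4 * 2 ^ L"
            using K[of L] False by (simp add: dyadic_density_def field_simps)
          ultimately show ?thesis using Suc.IH by simp
        qed
      qed (use \<open>e > 0\<close> in simp)
      obtain N :: nat where N: "2 ^ Suc K / e < real N" using reals_Archimedean2 by blast
      have "norm (real (card (A \<inter> {1..n})) / real n - 0) < e" if "n \<ge> max 1 N" for n
      proof -
        let ?L = "Suc (floor_log n)"
        have "n < 2 ^ ?L" using floor_log_exp2_gt[of n] by simp
        then have "card (A \<inter> {1..n}) \<le> card (A \<inter> {1..<2 ^ ?L})" by (intro card_mono) auto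
        then have "real (card (A \<inter> {1..n})) \<le> 2 ^ K + e / 4 * 2 ^ ?L"
          using bound[of ?L] by linarith
        moreover have "2 ^ floor_log n \<le> n" using that by (intro floor_log_exp2_le) auto
        then have "real (2 ^ floor_log n) \<le> real n" by (rule of_nat_mono)
        then have "e / 4 * 2 ^ ?L \<le> e / 2 * real n" using \<open>e > 0\<close> by simp
        moreover have "2 ^ K < e / 2 * real n"
        proof -
          have "2 ^ Suc K / e < real n" using N that by linarith
          then show ?thesis using \<open>e > 0\<close> by (simp add: field_simps)
        qed
        ultimately have "real (card (A \<inter> {1..n})) < e * real n" by simp
        then show ?thesis using that by (simp add: field_simps)
      qed
      then show "\<exists>N. \<forall>n\<ge>N. norm (real (card (A \<inter> {1..n})) / real n - 0) < e" by blast
    qed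
    then show "A \<in> Z_ideal" using assms by (auto simp: Z_ideal_def)
  qed
qed

text \<open>The code reduces \<^const>\<open>fin_rows\<close> continuously to \<^const>\<open>Z_ideal\<close>: a point in row \<open>m\<close> becomes
  a set of density \<open>2\<^sup>-\<^sup>m\<close> in its dyadic interval.  The exponent does not truncate since \<^term>\<open>row k \<le> k\<close>.\<close>

definition dyadic_code :: "(nat \<Rightarrow> bool) \<Rightarrow> nat set" where
  "dyadic_code z = {j. 0 < j \<and> z (floor_log j) \<and> j < 2 ^ floor_log j + 2 ^ (floor_log j - row (floor_log j))}"

lemma dyadic_density_code: "dyadic_density (dyadic_code z) = row_weight z"
proof
  fix k
  have fl: "floor_log j = k" if "2 ^ k \<le> j" "j < 2 ^ k + 2 ^ (k - row k)" for j
  proof (rule floor_log_eq_iff[THEN iffD2])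
    have "(2::nat) ^ (k - row k) \<le> 2 ^ k" by (intro power_increasing) auto
    then have "2 ^ k + 2 ^ (k - row k) \<le> (2 ^ Suc k :: nat)" unfolding power_Suc mult_2 by (rule add_left_mono)
    then show "2 ^ k \<le> j \<and> j < 2 ^ Suc k" using that by linarith
    have "(0::nat) < 2 ^ k" by simp
    then show "0 < j" using that by linarith
  qed
  have "j \<in> dyadic_code z \<and> floor_log j = k \<longleftrightarrow> z k \<and> 2 ^ k \<le> j \<and> j < 2 ^ k + 2 ^ (k - row k)" for j
  proof
    assume "j \<in> dyadic_code z \<and> floor_log j = k"
    then show "z k \<and> 2 ^ k \<le> j \<and> j < 2 ^ k + 2 ^ (k - row k)"
      unfolding dyadic_code_def using floor_log_exp2_le[of j] by blast
  next
    assume j: "z k \<and> 2 ^ k \<le> j \<and> j < 2 ^ k + 2 ^ (k - row k)"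
    have "(0::nat) < 2 ^ k" by simp
    then have "0 < j" using j by linarith
    then show "j \<in> dyadic_code z \<and> floor_log j = k" unfolding dyadic_code_def using j fl[of j] by simp
  qed
  then have set: "{j \<in> dyadic_code z. floor_log j = k} = (if z k then {2 ^ k..<2 ^ k + 2 ^ (k - row k)} else {})"
    unfolding set_eq_iff by simp
  have "(2::real) ^ k = 2 ^ (k - row k) * 2 ^ row k" using row_le[of k] by (simp flip: power_add)
  then show "dyadic_density (dyadic_code z) k = row_weight z k"
    unfolding dyadic_density_def row_weight_def set by (simp add: power_one_over)
qed

lemma dyadic_code_Z_ideal_iff: "dyadic_code z \<in> Z_ideal \<longleftrightarrow> z \<in> fin_rows"
proof -
  have "0 \<notin> dyadic_code z" by (simp add: dyadic_code_def)
  from Z_ideal_iff[OF this] show ?thesis by (simp only: dyadic_density_code row_weight_c0_iff)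
qed


section \<open>Consequences of \<open>FIN = EXH\<close>\<close>

context nice_extended_norm
begin

text \<open>All tails have norm at least \<open>e\<close>, and a tail norm is the limit of the norms
  of its finite pieces, so every tail contains a finite piece of norm above \<open>e / 2\<close>. A
  labelling \<open>\<kappa>\<close> records the pieces, because later arguments use no more about
  their position than finiteness.\<close>

lemma FIN_not_EXH_blocks:
  assumes x: "x \<in> FIN \<Phi>" "x \<notin> EXH \<Phi>"
  obtains \<kappa> \<epsilon> where "\<epsilon> > 0" "\<And>k. finite {i. \<kappa> i = (k::nat)}"
    "\<And>k. ennreal \<epsilon> \<le> \<Phi> (proj_on {i. \<kappa> i = k} x)"
proof -
  obtain e where e: "e > 0" "\<And>n. ennreal e \<le> \<Phi> (proj_on (- {..<n}) x)"
    using x(2) unfolding EXH_iff by (meson not_le)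
  have "\<exists>m>n. ennreal (e / 2) < \<Phi> (proj_on {n..<m} x)" for n
  proof (rule ccontr)
    assume neg: "\<not> ?thesis"
    have "\<Phi> (proj_on (- {..<n}) x) \<le> ennreal (e / 2)"
    proof (rule norm_leI)
      fix m
      \<comment> \<open>\<open>max m (Suc n)\<close> meets the requirement that a piece end after
        \<open>n\<close>.\<close>
      have "\<Phi> (proj_on {..<m} (proj_on (- {..<n}) x)) \<le> \<Phi> (proj_on {n..<max m (Suc n)} x)"
        unfolding proj_on_proj_on by (rule norm_proj_mono) auto
      also have "\<dots> \<le> ennreal (e / 2)" using neg by (metis less_Suc_eq_le max.cobounded2 not_le Suc_le_eq)
      finally show "\<Phi> (proj_on {..<m} (proj_on (- {..<n}) x)) \<le> ennreal (e / 2)" .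
    qed
    also have "\<dots> < ennreal e" using e(1) by (intro ennreal_lessI) auto
    finally show False using e(2)[of n] by simp
  qed
  then obtain nx where nx: "\<And>n. n < nx n" "\<And>n. ennreal (e / 2) < \<Phi> (proj_on {n..<nx n} x)"
    by metis
  define a where "a k = (nx ^^ k) 0" for k
  have a: "a 0 = 0" "a (Suc k) = nx (a k)" for k by (simp_all add: a_def)
  have mono: "strict_mono a" by (simp add: strict_mono_Suc_iff a nx)
  define \<kappa> where "\<kappa> i = (LEAST k. i < a (Suc k))" for i
  have fib: "{i. \<kappa> i = k} = {a k..<a (Suc k)}" for k
    using block_index_bounds[OF mono a(1)] block_index_unique[OF mono] by (auto simp: \<kappa>_def)
  show ?thesis
  proof
    show "e / 2 > 0" using e by simp
    show "finite {i. \<kappa> i = k}" for k by (simp add: fib)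
    show "ennreal (e / 2) \<le> \<Phi> (proj_on {i. \<kappa> i = k} x)" for k
      unfolding fib a(2) using nx(2) by (rule less_imp_le)
  qed
qed

lemma fsigma_in_FIN: "fsigma_in euclidean (FIN \<Phi>)"
proof -
  have "FIN \<Phi> = (\<Union>m::nat. {x. \<forall>n. proj_norm n x \<le> real m})"
    unfolding set_eq_iff FIN_iff_proj_norm by simp
  moreover have "closed {x. \<forall>n. proj_norm n x \<le> real m}" for m
    by (intro closed_Collect_all closed_Collect_le continuous_on_proj_norm continuous_intros)
  ultimately show ?thesis using fsigma_in_euclidean_UN[of "\<lambda>m. {x. \<forall>n. proj_norm n x \<le> real m}"] by simp
qed

text \<open>Finite sums of distinct unit vectors have sup norm at most 1, so their images under
  \<open>T\<close> have bounded finite subsums and form an unconditionally convergent series. Some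
  of its terms would have norm below the lower bound \<open>m\<close>.\<close>

lemma FIN_eq_EXH_no_copy_c0:
  assumes eq: "FIN \<Phi> = EXH \<Phi>"
  shows "\<not> contains_copy \<Phi> (EXH \<Phi>) sup_norm c0"
proof
  assume "contains_copy \<Phi> (EXH \<Phi>) sup_norm c0"
  then obtain T m M where T1: "T ` c0 \<subseteq> EXH \<Phi>"
    and T2: "\<forall>x\<in>c0. \<forall>y\<in>c0. T (x + y) = T x + T y"
    and m: "0 < m" and M: "0 < M"
    and bounds': "\<forall>x\<in>c0. ennreal m * sup_norm x \<le> \<Phi> (T x) \<and> \<Phi> (T x) \<le> ennreal M * sup_norm x"
    unfolding contains_copy_def by (elim exE conjE) (rule that)
  note T = T1 T2[rule_format]
  note bounds = bounds'[rule_format, THEN conjunct1] bounds'[rule_format, THEN conjunct2]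
  have sum_unit: "sum unit_seq F k = (if k \<in> F then 1 else 0)" if "finite F" for F k
    using that by (simp add: sum_fun_apply unit_seq_def)
  have sum_c0: "sum unit_seq F \<in> c0" if "finite F" for F
  proof -
    have "\<exists>N. \<forall>i\<in>F. i < N" using that unfolding finite_nat_set_iff_bounded .
    then obtain N where "\<forall>i\<in>F. i < N" ..
    then have "\<forall>\<^sub>F k in sequentially. sum unit_seq F k = 0"
      unfolding eventually_sequentially by (intro exI[of _ N]) (auto simp: sum_unit[OF that])
    then show ?thesis unfolding c0_def mem_Collect_eq by (rule tendsto_eventually)
  qed
  have unit_c0: "unit_seq n \<in> c0" for n using sum_c0[of "{n}"] by simp
  have "(0::rseq) \<in> c0" using sum_c0[of "{}"] by simp
  from T(2)[OF this this] have "T (0 + 0) = T 0 + T 0" .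
  then have T0: "T 0 = 0" by simp
  have Tsum: "(\<Sum>n\<in>F. T (unit_seq n)) = T (sum unit_seq F)" if "finite F" for F
    using that
  proof induction
    case (insert n F)
    from T(2)[OF unit_c0[of n] sum_c0[OF insert.hyps(1)]]
    show ?case unfolding sum.insert[OF insert.hyps] insert.IH by (rule sym)
  qed (simp only: sum.empty T0)
  have conv: "unconditionally_convergent \<Phi> (EXH \<Phi>) (\<lambda>n. T (unit_seq n)) UNIV"
  proof (rule bounded_sums_unconditionally_convergent[OF eq])
    show "(\<lambda>n. T (unit_seq n)) ` UNIV \<subseteq> EXH \<Phi>" using T(1) unit_c0 by blast
    show "\<Phi> (\<Sum>n\<in>F. T (unit_seq n)) \<le> ennreal M" if "finite F" for F
    proof -
      have "sup_norm (sum unit_seq F) \<le> 1"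
        unfolding sup_norm_def by (rule SUP_least) (simp add: sum_unit[OF that])
      then have "ennreal M * sup_norm (sum unit_seq F) \<le> ennreal M * 1" by (rule mult_left_mono) simp
      with bounds(2)[OF sum_c0[OF that]] show ?thesis unfolding Tsum[OF that] by simp
    qed
  qed (use M in simp)
  obtain F0 where F0: "finite F0" "F0 \<subseteq> UNIV"
    "\<And>F. finite F \<Longrightarrow> F0 \<subseteq> F \<Longrightarrow> F \<subseteq> UNIV \<Longrightarrow>
      \<Phi> ((\<Sum>n\<in>F. T (unit_seq n)) - (\<Sum>n\<in>F0. T (unit_seq n))) < ennreal m"
    by (rule unconditionally_convergentD[OF conv m]) (rule that)
  obtain n where n: "n \<notin> F0" using F0(1) ex_new_if_finite infinite_UNIV_nat by blast
  have "(\<Sum>i\<in>insert n F0. T (unit_seq i)) - (\<Sum>i\<in>F0. T (unit_seq i)) = T (unit_seq n)"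
    unfolding sum.insert[OF F0(1) n] by (rule add_diff_cancel_right')
  then have "\<Phi> (T (unit_seq n)) < ennreal m" using F0(3)[of "insert n F0"] F0(1) by auto
  moreover have "1 \<le> sup_norm (unit_seq n)"
    unfolding sup_norm_def by (rule SUP_upper2[of n]) (auto simp: unit_seq_def)
  then have "ennreal m * 1 \<le> ennreal m * sup_norm (unit_seq n)" by (rule mult_left_mono) simp
  ultimately show False using bounds(1)[OF unit_c0[of n]] by simp
qed

lemma sum_unit_seq: "(\<Sum>n<N. scale_seq (a n) (unit_seq n)) = proj_on {..<N} a"
  by (auto simp: fun_eq_iff proj_on_def sum_fun_apply scale_seq_def unit_seq_def if_distrib[of "(*) _"] cong: if_cong)

text \<open>Partial sums are truncations, so their errors are the tails that define
  \<open>EXH\<close>; bounded coordinate functionals leave \<open>a\<close> as the only possible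
  limit.\<close>

lemma unit_series_converges_iff:
  "series_converges_to \<Phi> (EXH \<Phi>) (\<lambda>n. scale_seq (a n) (unit_seq n)) s \<longleftrightarrow> a \<in> EXH \<Phi> \<and> s = a"
  unfolding series_converges_to_def limitin_norm_topology_iff[OF EXH_subset_FIN] sum_unit_seq
proof
  assume *: "s \<in> EXH \<Phi> \<and> (\<forall>e>0. \<forall>\<^sub>F N in sequentially.
    proj_on {..<N} a \<in> EXH \<Phi> \<and> \<Phi> (proj_on {..<N} a - s) < ennreal e)"
  have "s i = a i" for i
  proof (rule ccontr)
    assume "s i \<noteq> a i"
    define e where "e = \<bar>a i - s i\<bar> * enn2real (\<Phi> (unit_seq i))"
    have "e > 0" using \<open>s i \<noteq> a i\<close> norm_unit_pos by (simp add: e_def)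
    then have "\<forall>\<^sub>F N in sequentially. \<Phi> (proj_on {..<N} a - s) < ennreal e"
      using * by (auto elim: eventually_mono)
    then have "\<forall>\<^sub>F N in sequentially. \<Phi> (proj_on {..<N} a - s) < ennreal e \<and> N > i"
      using eventually_gt_at_top by (rule eventually_conj)
    then obtain N where N: "\<Phi> (proj_on {..<N} a - s) < ennreal e" "N > i"
      using eventually_happens trivial_limit_sequentially by blast
    have "ennreal e \<le> \<Phi> (proj_on {..<N} a - s)"
      using norm_coordinate_le[of "proj_on {..<N} a - s" i] N(2) by (simp add: e_def proj_on_def)
    then show False using N(1) by simp
  qed
  then have "s = a" by auto
  then show "a \<in> EXH \<Phi> \<and> s = a" using * by simp
next
  assume a: "a \<in> EXH \<Phi> \<and> s = a"
  have "\<forall>\<^sub>F N in sequentially. proj_on {..<N} a \<in> EXH \<Phi> \<and> \<Phi> (proj_on {..<N} a - s) < ennreal e"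
    if "e > 0" for e
  proof -
    have "\<Phi> (proj_on {..<N} a - s) = \<Phi> (proj_on (- {..<N}) a)" for N
      using a by (intro antisym norm_mono) (auto simp: proj_on_def)
    moreover have "\<forall>\<^sub>F N in sequentially. \<Phi> (proj_on (- {..<N}) a) < ennreal e"
      using a that unfolding EXH_def by (intro order_tendstoD(2)[of _ 0]) auto
    moreover have "proj_on {..<N} a \<in> EXH \<Phi>" for N
      by (rule EXH_finite_support) (auto simp: proj_on_def elim: rev_finite_subset)
    ultimately show ?thesis by simp
  qed
  then show "s \<in> EXH \<Phi> \<and> (\<forall>e>0. \<forall>\<^sub>F N in sequentially.
    proj_on {..<N} a \<in> EXH \<Phi> \<and> \<Phi> (proj_on {..<N} a - s) < ennreal e)"
    using a by simp
qed

text \<open>The supremum of the norms of the partial sums is \<open>\<Phi> a\<close>, so bounded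
  completeness says literally that \<open>FIN \<Phi>\<close> is contained in
  \<open>EXH \<Phi>\<close>.\<close>

lemma boundedly_complete_iff: "boundedly_complete_basis \<Phi> (EXH \<Phi>) unit_seq \<longleftrightarrow> FIN \<Phi> = EXH \<Phi>"
proof -
  have "range unit_seq \<subseteq> EXH \<Phi>"
    by (auto intro!: EXH_finite_support simp: unit_seq_def)
  then have "schauder_basis \<Phi> (EXH \<Phi>) unit_seq"
    unfolding schauder_basis_def unit_series_converges_iff by auto
  moreover have "(SUP N. \<Phi> (\<Sum>n<N. scale_seq (a n) (unit_seq n))) = \<Phi> a" for a
    unfolding sum_unit_seq
  proof (rule antisym)
    show "(SUP N. \<Phi> (proj_on {..<N} a)) \<le> \<Phi> a" by (intro SUP_least norm_proj_le)
    show "\<Phi> a \<le> (SUP N. \<Phi> (proj_on {..<N} a))" by (rule norm_leI) (intro SUP_upper UNIV_I)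
  qed
  ultimately have "boundedly_complete_basis \<Phi> (EXH \<Phi>) unit_seq \<longleftrightarrow> (\<forall>a. \<Phi> a < \<infinity> \<longrightarrow> a \<in> EXH \<Phi>)"
    unfolding boundedly_complete_basis_def unit_series_converges_iff by simp
  also have "\<dots> \<longleftrightarrow> FIN \<Phi> = EXH \<Phi>" unfolding FIN_iff[symmetric] using EXH_subset_FIN by blast
  finally show ?thesis .
qed

lemma norm_dense:
  fixes D :: "rseq set"
  assumes D: "\<And>X. open X \<Longrightarrow> X \<noteq> {} \<Longrightarrow> \<exists>q\<in>D. q \<in> X" and "e > 0"
  shows "\<exists>q\<in>D. proj_norm n (x - q) < e"
proof -
  have cont: "continuous_on UNIV (\<lambda>q. proj_norm n (x - q))"
  proof (rule continuous_on_compose2[OF continuous_on_proj_norm])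
    show "continuous_on UNIV (\<lambda>q. x - q)"
    proof (rule continuous_on_coordinatewise_then_product)
      show "continuous_on UNIV (\<lambda>q :: rseq. (x - q) i)" for i
        unfolding minus_apply by (intro continuous_intros continuous_on_product_coordinates)
    qed
  qed simp
  have "open {q. proj_norm n (x - q) < e}" by (intro open_Collect_less cont continuous_intros)
  moreover have "x \<in> {q. proj_norm n (x - q) < e}" using \<open>e > 0\<close> by (simp only: mem_Collect_eq diff_self proj_norm_zero)
  ultimately show ?thesis using D by blast
qed

text \<open>Truncations of a countable dense subset of the product space are dense: tails are small
  in \<open>EXH \<Phi>\<close>, and heads are approximated through \<open>norm_dense\<close>.
  Truncating puts the approximants into \<open>FIN \<Phi>\<close>.\<close>

lemma FIN_eq_EXH_separable:
  assumes eq: "FIN \<Phi> = EXH \<Phi>"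
  shows "separable_space (norm_topology \<Phi> (FIN \<Phi>))"
proof -
  obtain D :: "rseq set" where D: "countable D" "\<And>X. open X \<Longrightarrow> X \<noteq> {} \<Longrightarrow> \<exists>q\<in>D. q \<in> X"
    by (rule countable_dense_setE) blast
  interpret M: Metric_space "FIN \<Phi>" "\<lambda>x y. enn2real (\<Phi> (x - y))" by (rule Metric_space_norm) simp
  define C where "C = (\<lambda>(n, q). proj_on {..<n} q) ` (UNIV \<times> D)"
  have "countable C" unfolding C_def using D(1) by auto
  moreover have CF: "C \<subseteq> FIN \<Phi>" by (auto simp: C_def FIN_iff intro!: norm_proj_finite[unfolded infinity_ennreal_def])
  moreover have "\<exists>c\<in>C. c \<in> M.mball x r" if x: "x \<in> FIN \<Phi>" and "r > 0" for x r
  proof -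
    obtain n where n: "\<Phi> (proj_on (- {..<n}) x) < ennreal (r / 2)"
      using x \<open>r > 0\<close> unfolding eq EXH_iff by (meson half_gt_zero)
    obtain q where q: "q \<in> D" "proj_norm n (x - q) < r / 2"
      using norm_dense[of D "r / 2" n x] D(2) \<open>r > 0\<close> by auto
    let ?c = "proj_on {..<n} q"
    have "?c \<in> C" using q(1) by (force simp: C_def)
    have "x - ?c = proj_on (- {..<n}) x + proj_on {..<n} (x - q)"
      by (auto simp: proj_on_def fun_eq_iff)
    then have "\<Phi> (x - ?c) \<le> \<Phi> (proj_on (- {..<n}) x) + \<Phi> (proj_on {..<n} (x - q))"
      by (metis norm_triangle)
    also have "\<dots> < ennreal (r / 2) + ennreal (r / 2)"
      using n q(2) proj_norm_nonneg \<open>r > 0\<close> by (intro add_strict_mono) (auto simp: ennreal_less_iff simp flip: ennreal_proj_norm)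
    also have "\<dots> = ennreal r" using \<open>r > 0\<close> by (simp flip: ennreal_plus)
    finally have "enn2real (\<Phi> (x - ?c)) < r"
      using x CF \<open>?c \<in> C\<close> \<open>r > 0\<close> by (subst enn2real_norm_less_iff) (auto intro!: FIN_diff)
    then show ?thesis using \<open>?c \<in> C\<close> x CF by (intro bexI[of _ ?c]) auto
  qed
  ultimately show ?thesis
    unfolding separable_space_def norm_topology_def M.topspace_mtopology M.metric_closure_of
    by (intro exI[of _ C]) auto
qed

text \<open>The Kuratowski embedding \<open>x \<mapsto> (\<Phi> (P\<^sub>n (x - q)))\<close> into \<open>\<ell>\<^sub>\<infinity>\<close>, with \<open>q\<close> ranging over a
  countable dense set, replaces a norming sequence of functionals.\<close>

lemma FIN_borel_reducible_linf: "borel_reducible (coset_rel (FIN \<Phi>)) (coset_rel linf)"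
proof -
  obtain D :: "rseq set" where D: "countable D" "\<And>X. open X \<Longrightarrow> X \<noteq> {} \<Longrightarrow> \<exists>q\<in>D. q \<in> X"
    by (rule countable_dense_setE) blast
  have "D \<noteq> {}" using D(2)[of UNIV] by blast
  define q where "q = from_nat_into D"
  have rq: "range q = D" unfolding q_def using \<open>D \<noteq> {}\<close> D(1) by (rule range_from_nat_into)
  define f where "f x j = proj_norm (fst (prod_decode j)) (x - q (snd (prod_decode j)))" for x j
  have "continuous_on UNIV f"
  proof (rule continuous_on_coordinatewise_then_product)
    fix j
    have "continuous_on UNIV (\<lambda>x. x - q (snd (prod_decode j)))"
    proof (rule continuous_on_coordinatewise_then_product)
      show "continuous_on UNIV (\<lambda>x :: rseq. (x - q (snd (prod_decode j))) i)" for i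
        unfolding minus_apply by (intro continuous_intros continuous_on_product_coordinates)
    qed
    then show "continuous_on UNIV (\<lambda>x. f x j)"
      unfolding f_def by (rule continuous_on_compose2[OF continuous_on_proj_norm]) simp
  qed
  then have "f \<in> borel_measurable borel" by (rule borel_measurable_continuous_onI)
  moreover have "x - y \<in> FIN \<Phi> \<longleftrightarrow> f x - f y \<in> linf" for x y
  proof
    assume "x - y \<in> FIN \<Phi>"
    then obtain m where m: "\<And>n. proj_norm n (x - y) \<le> real m" using FIN_iff_proj_norm by blast
    have "norm ((f x - f y) j) \<le> real m" for j
    proof -
      have "\<bar>f x j - f y j\<bar> \<le> proj_norm (fst (prod_decode j)) (x - q (snd (prod_decode j)) - (y - q (snd (prod_decode j))))"
        unfolding f_def by (rule proj_norm_diff_le)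
      then show ?thesis using m[of "fst (prod_decode j)"] by simp
    qed
    then show "f x - f y \<in> linf" unfolding linf_def bounded_iff by blast
  next
    assume "f x - f y \<in> linf"
    then obtain b where b: "\<And>j. \<bar>f x j - f y j\<bar> \<le> b" unfolding linf_def bounded_iff by auto
    \<comment> \<open>A point \<open>p\<close> within 1 of \<open>y\<close> is used twice below, and
      each use adds 1 to the bound \<open>b\<close>.\<close>
    obtain m :: nat where m: "b + 2 \<le> real m" using real_arch_simple by blast
    have "proj_norm n (x - y) \<le> real m" for n
    proof -
      obtain p where p: "p \<in> D" "proj_norm n (y - p) < 1"
        using norm_dense[of D 1 n y] D(2) by auto
      then obtain k where k: "p = q k" using rq by blast
      have "\<bar>proj_norm n (x - p) - proj_norm n (y - p)\<bar> \<le> b"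
        using b[of "prod_encode (n, k)"] by (simp add: f_def k)
      moreover have "\<bar>proj_norm n (x - p) - proj_norm n (x - y)\<bar> \<le> proj_norm n (y - p)"
        using proj_norm_diff_le[of n "x - p" "x - y"] by simp
      ultimately show ?thesis using p(2) m by linarith
    qed
    then show "x - y \<in> FIN \<Phi>" unfolding FIN_iff_proj_norm by blast
  qed
  ultimately show ?thesis unfolding borel_reducible_def coset_rel_def by auto
qed

text \<open>Turns convergence into a countable union over \<open>n\<close> of conditions on finite
  subsets, the form treated by \<open>closed_bounded_subsets\<close>.\<close>

lemma unconditionally_convergent_iff_bounded:
  assumes "FIN \<Phi> = EXH \<Phi>" "u ` A \<subseteq> EXH \<Phi>"
  shows "unconditionally_convergent \<Phi> (EXH \<Phi>) u A \<longleftrightarrow>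
    (\<exists>n::nat. \<forall>F. finite F \<and> F \<subseteq> A \<longrightarrow> \<Phi> (sum u F) \<le> ennreal (real n))"
proof
  assume "unconditionally_convergent \<Phi> (EXH \<Phi>) u A"
  then obtain n where "\<And>F. finite F \<Longrightarrow> F \<subseteq> A \<Longrightarrow> \<Phi> (sum u F) \<le> ennreal (real n)"
    using unconditionally_convergent_bounded[OF _ assms(2)] by metis
  then show "\<exists>n::nat. \<forall>F. finite F \<and> F \<subseteq> A \<longrightarrow> \<Phi> (sum u F) \<le> ennreal (real n)" by blast
next
  assume "\<exists>n::nat. \<forall>F. finite F \<and> F \<subseteq> A \<longrightarrow> \<Phi> (sum u F) \<le> ennreal (real n)"
  then obtain n where "\<And>F. finite F \<Longrightarrow> F \<subseteq> A \<Longrightarrow> \<Phi> (sum u F) \<le> ennreal (real n)" by blast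
  then show "unconditionally_convergent \<Phi> (EXH \<Phi>) u A"
    by (rule bounded_sums_unconditionally_convergent[OF assms]) auto
qed

lemma FIN_eq_EXH_representable_fsigma:
  assumes eq: "FIN \<Phi> = EXH \<Phi>" and rep: "representable_on UNIV I \<Phi> (EXH \<Phi>)"
  shows "fsigma_family I"
proof -
  obtain u where u: "u ` UNIV \<subseteq> EXH \<Phi>" "I = {A. unconditionally_convergent \<Phi> (EXH \<Phi>) u A}"
    using rep unfolding representable_on_def by auto
  define C where "C n = {z. \<forall>F. finite F \<and> F \<subseteq> Collect z \<longrightarrow> \<Phi> (sum u F) \<le> ennreal (real n)}" for n :: nat
  have "Collect -` I = (\<Union>n. C n)"
    using u(1) by (auto simp: u(2) C_def unconditionally_convergent_iff_bounded[OF eq] image_subset_iff)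
  moreover have "closed (C n)" for n
    unfolding C_def by (rule closed_bounded_subsets) (simp add: closed_coordinate_False)
  ultimately show ?thesis unfolding fsigma_family_def using fsigma_in_euclidean_UN by metis
qed

text \<open>Pulled back along \<open>dyadic_code\<close>, a representation of \<open>Z_ideal\<close>
  would exhibit \<open>fin_rows\<close> as F-sigma.\<close>

lemma FIN_eq_EXH_Z_ideal_not_representable:
  assumes eq: "FIN \<Phi> = EXH \<Phi>"
  shows "\<not> representable_on (UNIV - {0}) Z_ideal \<Phi> (EXH \<Phi>)"
proof
  assume "representable_on (UNIV - {0}) Z_ideal \<Phi> (EXH \<Phi>)"
  then obtain u where u: "u ` (UNIV - {0}) \<subseteq> EXH \<Phi>"
    "Z_ideal = {A. A \<subseteq> UNIV - {0} \<and> unconditionally_convergent \<Phi> (EXH \<Phi>) u A}"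
    unfolding representable_on_def by blast
  define C where "C n = {z. \<forall>F. finite F \<and> F \<subseteq> dyadic_code z \<longrightarrow> \<Phi> (sum u F) \<le> ennreal (real n)}" for n :: nat
  have "z \<in> fin_rows \<longleftrightarrow> (\<exists>n. z \<in> C n)" for z
  proof -
    have sub: "dyadic_code z \<subseteq> UNIV - {0}" by (auto simp: dyadic_code_def)
    then have "u ` dyadic_code z \<subseteq> EXH \<Phi>" using u(1) by blast
    from unconditionally_convergent_iff_bounded[OF eq this]
    have "(\<exists>n. z \<in> C n) \<longleftrightarrow> unconditionally_convergent \<Phi> (EXH \<Phi>) u (dyadic_code z)"
      by (simp add: C_def)
    also have "\<dots> \<longleftrightarrow> dyadic_code z \<in> Z_ideal" using sub u(2) by blast
    finally show ?thesis by (simp add: dyadic_code_Z_ideal_iff)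
  qed
  then have "fin_rows = (\<Union>n. C n)" by auto
  moreover have "closed (C n)" for n
    unfolding C_def
  proof (rule closed_bounded_subsets)
    show "closed {z. j \<notin> dyadic_code z}" for j
    \<comment> \<open>Membership of \<open>j\<close> in the code depends on the single coordinate
      \<open>floor_log j\<close>, or fails for every \<open>z\<close>.\<close>
    proof (cases "0 < j \<and> j < 2 ^ floor_log j + 2 ^ (floor_log j - row (floor_log j))")
      case True
      then have "{z. j \<notin> dyadic_code z} = {z. \<not> z (floor_log j)}" by (auto simp: dyadic_code_def)
      then show ?thesis by (simp only: closed_coordinate_False)
    next
      case False
      then have "{z. j \<notin> dyadic_code z} = UNIV" by (auto simp: dyadic_code_def)
      then show ?thesis by (simp only: closed_UNIV)
    qed
  qed
  ultimately have "fsigma_in euclidean fin_rows" using fsigma_in_euclidean_UN by metis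
  then show False using fin_rows_not_fsigma by blast
qed

lemma proj_in_EXH_iff: "proj_on A \<sigma> \<in> EXH \<Phi> \<longleftrightarrow> A \<in> Exh_subm (\<lambda>A. \<Phi> (proj_on A \<sigma>))"
proof -
  have "proj_on (- {..<n}) (proj_on A \<sigma>) = proj_on (A - {..<n}) \<sigma>" for n
    by (auto simp: proj_on_def)
  then show ?thesis by (simp add: EXH_def Exh_subm_def)
qed

text \<open>The choice \<open>A = UNIV\<close> recovers every sequence as some
  \<open>proj_on A \<sigma>\<close>, and each submeasure condition is membership of such a
  projection.\<close>

lemma submeasures_iff:
  "FIN \<Phi> = EXH \<Phi> \<longleftrightarrow>
    (\<forall>\<sigma>. Exh_subm (\<lambda>A. \<Phi> (proj_on A \<sigma>)) = Fin_subm (\<lambda>A. \<Phi> (proj_on A \<sigma>)))"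
proof -
  have fin: "proj_on A \<sigma> \<in> FIN \<Phi> \<longleftrightarrow> A \<in> Fin_subm (\<lambda>A. \<Phi> (proj_on A \<sigma>))" for A \<sigma>
    by (simp add: FIN_def Fin_subm_def)
  have "proj_on UNIV \<sigma> = \<sigma>" for \<sigma> by (simp add: proj_on_def)
  then have "FIN \<Phi> = EXH \<Phi> \<longleftrightarrow> (\<forall>A \<sigma>. proj_on A \<sigma> \<in> EXH \<Phi> \<longleftrightarrow> proj_on A \<sigma> \<in> FIN \<Phi>)"
    by (metis set_eqI)
  then show ?thesis unfolding fin proj_in_EXH_iff by blast
qed

end


section \<open>Block sequences equivalent to the basis of \<open>c\<^sub>0\<close>\<close>

text \<open>The pieces of \<open>x\<close> over the fibres of \<open>\<kappa>\<close> behave like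
  the unit vectors of c0: a single piece bounds a combination from below, and monotonicity with
  \<open>norm_upper\<close> bounds it from above.\<close>

locale c0_block = nice_extended_norm +
  fixes x :: rseq and \<kappa> :: "nat \<Rightarrow> nat" and \<epsilon> B :: real
  assumes eps_pos: "\<epsilon> > 0" and B_pos: "B > 0"
    and finite_block: "\<And>k. finite {i. \<kappa> i = k}"
    and block_lower: "\<And>k. ennreal \<epsilon> \<le> \<Phi> (proj_on {i. \<kappa> i = k} x)"
    and norm_upper: "\<Phi> x \<le> ennreal B"
begin

text \<open>The formal sum of \<open>y k\<close> times the \<open>k\<close>-th piece of
  \<open>x\<close>, defined for every sequence so that it serves both as an embedding of c0 and as a
  reduction on all sequences.\<close>

definition spread :: "rseq \<Rightarrow> rseq" where
  "spread y = (\<lambda>i. y (\<kappa> i) * x i)"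

lemma spread_add: "spread (y + z) = spread y + spread z"
  by (auto simp: spread_def algebra_simps)

lemma spread_diff: "spread (y - z) = spread y - spread z"
  by (auto simp: spread_def algebra_simps)

lemma spread_scale: "spread (scale_seq c y) = scale_seq c (spread y)"
  by (auto simp: spread_def scale_seq_def)

lemma spread_sum: "spread (sum f F) = (\<Sum>i\<in>F. spread (f i))"
  by (auto simp: spread_def fun_eq_iff sum_fun_apply sum_distrib_right)

lemma spread_upper:
  assumes "\<And>k. \<bar>y k\<bar> \<le> c" "c \<ge> 0"
  shows "\<Phi> (spread y) \<le> ennreal (c * B)"
proof -
  have "\<Phi> (spread y) \<le> ennreal c * \<Phi> x"
    using assms by (intro norm_dominated) (auto simp: spread_def abs_mult mult_right_mono)
  also have "\<dots> \<le> ennreal c * ennreal B" using norm_upper by (rule mult_left_mono) simp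
  also have "\<dots> = ennreal (c * B)" using assms(2) B_pos by (simp add: ennreal_mult)
  finally show ?thesis .
qed

lemma spread_block_lower:
  assumes "{i. \<kappa> i = k} \<subseteq> A"
  shows "ennreal (\<bar>y k\<bar> * \<epsilon>) \<le> \<Phi> (proj_on A (spread y))"
proof -
  have "ennreal (\<bar>y k\<bar> * \<epsilon>) = ennreal \<bar>y k\<bar> * ennreal \<epsilon>" using eps_pos by (simp add: ennreal_mult)
  also have "\<dots> \<le> ennreal \<bar>y k\<bar> * \<Phi> (proj_on {i. \<kappa> i = k} x)"
    using block_lower by (rule mult_left_mono) simp
  also have "\<dots> = \<Phi> (scale_seq (y k) (proj_on {i. \<kappa> i = k} x))" by (simp add: norm_scale)
  also have "\<dots> \<le> \<Phi> (proj_on A (spread y))"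
    using assms by (intro norm_mono) (auto simp: scale_seq_def proj_on_def spread_def)
  finally show ?thesis .
qed

lemma spread_lower: "ennreal (\<bar>y k\<bar> * \<epsilon>) \<le> \<Phi> (spread y)"
  using spread_block_lower[of k UNIV y] by (simp add: proj_on_def)

text \<open>Only finitely many blocks meet \<open>{..<n}\<close>, so late blocks lie inside a tail
  and force \<open>y\<close> to 0. Conversely, the first \<open>K\<close> blocks, being finite, end
  before some \<open>n\<close>, and beyond it all coefficients are small.\<close>

lemma spread_in_EXH_iff: "spread y \<in> EXH \<Phi> \<longleftrightarrow> y \<in> c0"
proof
  assume TE: "spread y \<in> EXH \<Phi>"
  have "y \<longlonglongrightarrow> 0"
  proof (rule LIMSEQ_I)
    fix d :: real assume "d > 0"
    then have "d * \<epsilon> > 0" using eps_pos by simp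
    then obtain n where n: "\<Phi> (proj_on (- {..<n}) (spread y)) < ennreal (d * \<epsilon>)"
      using TE unfolding EXH_iff by meson
    have "finite (\<kappa> ` {..<n})" by simp
    then have "\<exists>K. \<forall>k\<in>\<kappa> ` {..<n}. k < K" unfolding finite_nat_set_iff_bounded .
    then obtain K where K: "\<forall>k\<in>\<kappa> ` {..<n}. k < K" ..
    have "norm (y k - 0) < d" if "k \<ge> K" for k
    proof -
      have "\<kappa> i < K" if "i < n" for i using K that by simp
      then have "{i. \<kappa> i = k} \<subseteq> - {..<n}" using that by (auto simp: not_le[symmetric])
      from spread_block_lower[OF this] n have "ennreal (\<bar>y k\<bar> * \<epsilon>) < ennreal (d * \<epsilon>)" by (rule le_less_trans)
      then show ?thesis using eps_pos by (simp add: ennreal_less_iff)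
    qed
    then show "\<exists>K. \<forall>k\<ge>K. norm (y k - 0) < d" by blast
  qed
  then show "y \<in> c0" by (simp add: c0_def)
next
  assume "y \<in> c0"
  then have lim: "y \<longlonglongrightarrow> 0" by (simp add: c0_def)
  show "spread y \<in> EXH \<Phi>" unfolding EXH_iff
  proof (intro allI impI)
    fix e :: real assume "e > 0"
    define d where "d = e / (2 * B)"
    have "d > 0" using \<open>e > 0\<close> B_pos by (simp add: d_def)
    then obtain K where K: "\<And>k. k \<ge> K \<Longrightarrow> \<bar>y k\<bar> < d"
      using LIMSEQ_D[OF lim] by (auto simp: real_norm_def)
    have "finite (\<Union>k<K. {i. \<kappa> i = k})" using finite_block by blast
    then have "\<exists>n. \<forall>i\<in>(\<Union>k<K. {i. \<kappa> i = k}). i < n" unfolding finite_nat_set_iff_bounded .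
    then obtain n where n: "\<forall>i\<in>(\<Union>k<K. {i. \<kappa> i = k}). i < n" ..
    have far: "\<kappa> i \<ge> K" if "i \<ge> n" for i
    proof (rule ccontr)
      assume "\<not> ?thesis"
      then have "i \<in> (\<Union>k<K. {i. \<kappa> i = k})" by simp
      then have "i < n" using n by (rule bspec[rotated])
      then show False using that by simp
    qed
    have "\<Phi> (proj_on (- {..<n}) (spread y)) \<le> \<Phi> (spread (\<lambda>k. if k \<ge> K then y k else 0))"
      using far by (intro norm_mono) (auto simp: proj_on_def spread_def)
    also have "\<dots> \<le> ennreal (d * B)"
      using K \<open>d > 0\<close> by (intro spread_upper) (auto intro: less_imp_le)
    also have "\<dots> < ennreal e"
      using \<open>e > 0\<close> B_pos by (intro ennreal_lessI) (auto simp: d_def)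
    finally show "\<exists>n. \<Phi> (proj_on (- {..<n}) (spread y)) < ennreal e" by blast
  qed
qed

lemma spread_unit_in_EXH: "spread (scale_seq c (unit_seq k)) \<in> EXH \<Phi>"
proof (rule EXH_finite_support, rule finite_subset[OF _ finite_block[of k]])
  show "{n. spread (scale_seq c (unit_seq k)) n \<noteq> 0} \<subseteq> {i. \<kappa> i = k}"
    by (auto simp: spread_def scale_seq_def unit_seq_def)
qed

lemma continuous_on_spread: "continuous_on UNIV spread"
proof (rule continuous_on_coordinatewise_then_product)
  show "continuous_on UNIV (\<lambda>y. spread y i)" for i
    unfolding spread_def by (intro continuous_intros continuous_on_product_coordinates)
qed

lemma EXH_not_fsigma: "\<not> fsigma_in euclidean (EXH \<Phi>)"
proof
  assume "fsigma_in euclidean (EXH \<Phi>)"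
  then obtain C :: "nat \<Rightarrow> rseq set" where C: "\<And>n. closed (C n)" "EXH \<Phi> = (\<Union>n. C n)"
    by (rule fsigma_in_euclideanD) (rule that)
  have mem: "z \<in> fin_rows \<longleftrightarrow> (\<exists>n. spread (row_weight z) \<in> C n)" for z
  proof -
    have "z \<in> fin_rows \<longleftrightarrow> spread (row_weight z) \<in> EXH \<Phi>" by (simp add: spread_in_EXH_iff row_weight_c0_iff)
    then show ?thesis by (simp add: C(2))
  qed
  have "continuous_on UNIV (\<lambda>z. spread (row_weight z))"
    by (rule continuous_on_compose2[OF continuous_on_spread continuous_on_row_weight]) simp
  then have "closed ((\<lambda>z. spread (row_weight z)) -` C n)" for n by (intro closed_vimage C(1))
  then have "fsigma_in euclidean (\<Union>n. (\<lambda>z. spread (row_weight z)) -` C n)" by (rule fsigma_in_euclidean_UN)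
  moreover have "(\<Union>n. (\<lambda>z. spread (row_weight z)) -` C n) = fin_rows"
    unfolding set_eq_iff mem by simp
  ultimately show False using fin_rows_not_fsigma by simp
qed

lemma contains_copy_c0: "contains_copy \<Phi> (EXH \<Phi>) sup_norm c0"
proof -
  have lower: "ennreal \<epsilon> * sup_norm y \<le> \<Phi> (spread y)" for y
  proof -
  have "ennreal \<epsilon> * sup_norm y = (SUP k. ennreal \<epsilon> * ennreal \<bar>y k\<bar>)"
    unfolding sup_norm_def by (simp add: SUP_mult_left_ennreal)
  also have "\<dots> \<le> \<Phi> (spread y)"
    using spread_lower[of y] eps_pos by (intro SUP_least) (simp add: ennreal_mult mult.commute)
  finally show ?thesis .
  qed
  have upper: "\<Phi> (spread y) \<le> ennreal B * sup_norm y" if y: "y \<in> c0" for y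
  proof -
  have "Bseq y" using y by (auto simp: c0_def intro: convergent_imp_Bseq convergentI)
  then obtain b where b: "b > 0" "\<And>k. \<bar>y k\<bar> \<le> b" by (auto elim: BseqE)
  have "sup_norm y \<le> ennreal b"
    unfolding sup_norm_def using b by (intro SUP_least ennreal_leI) auto
  then have "sup_norm y < \<infinity>" by (rule le_less_trans) simp
  then have eq: "sup_norm y = ennreal (enn2real (sup_norm y))" by simp
  have "ennreal \<bar>y k\<bar> \<le> sup_norm y" for k unfolding sup_norm_def by (rule SUP_upper) simp
  then have "\<bar>y k\<bar> \<le> enn2real (sup_norm y)" for k by (subst (asm) eq) simp
  then have "\<Phi> (spread y) \<le> ennreal (enn2real (sup_norm y) * B)" by (rule spread_upper) simp
  also have "\<dots> = ennreal B * sup_norm y"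
    by (subst (2) eq) (use B_pos in \<open>simp add: ennreal_mult mult.commute\<close>)
  finally show ?thesis .
  qed
  have "\<exists>m M. 0 < m \<and> 0 < M \<and>
      (\<forall>y\<in>c0. ennreal m * sup_norm y \<le> \<Phi> (spread y) \<and> \<Phi> (spread y) \<le> ennreal M * sup_norm y)"
    
    by (rule exI[of _ \<epsilon>], rule exI[of _ B]) (intro conjI ballI eps_pos B_pos lower upper)
  moreover have "spread ` c0 \<subseteq> EXH \<Phi>" using spread_in_EXH_iff by auto
  ultimately show ?thesis
    unfolding contains_copy_def using spread_add spread_scale by (intro exI[of _ spread] conjI ballI allI)
qed

text \<open>The images of all 0-1 sequences lie in \<open>FIN \<Phi>\<close> at mutual distance at
  least \<open>\<epsilon>\<close>. Approximating them within \<open>\<epsilon> / 2\<close> from a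
  countable set would inject the power set of \<open>nat\<close> into it.\<close>

lemma FIN_not_separable: "\<not> separable_space (norm_topology \<Phi> (FIN \<Phi>))"
proof
  interpret M: Metric_space "FIN \<Phi>" "\<lambda>x y. enn2real (\<Phi> (x - y))" by (rule Metric_space_norm) simp
  define v :: "nat set \<Rightarrow> rseq" where "v A = spread (\<lambda>k. if k \<in> A then 1 else 0)" for A
  have vF: "v A \<in> FIN \<Phi>" for A
  proof -
    have "\<Phi> (v A) \<le> ennreal (1 * B)" unfolding v_def by (rule spread_upper) auto
    then show ?thesis unfolding FIN_iff by (rule le_less_trans) simp
  qed
  have sep: "ennreal \<epsilon> \<le> \<Phi> (v A - v A')" if "A \<noteq> A'" for A A'
  proof -
    have "\<exists>k. k \<in> A \<longleftrightarrow> k \<notin> A'" using that by auto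
    then obtain k where "k \<in> A \<longleftrightarrow> k \<notin> A'" ..
    then show ?thesis
      using spread_lower[of "(\<lambda>k. if k \<in> A then 1 else 0) - (\<lambda>k. if k \<in> A' then 1 else 0)" k]
      unfolding spread_diff v_def by (auto split: if_splits)
  qed
  assume "separable_space (norm_topology \<Phi> (FIN \<Phi>))"
  then obtain C where C: "countable C" "C \<subseteq> FIN \<Phi>" "M.mtopology closure_of C = FIN \<Phi>"
    unfolding separable_space_def norm_topology_def M.topspace_mtopology by blast
  have "\<exists>c\<in>C. \<Phi> (v A - c) < ennreal (\<epsilon> / 2)" for A
  proof -
    have "v A \<in> M.mtopology closure_of C" using vF C(3) by simp
    then obtain c where c: "c \<in> C" "enn2real (\<Phi> (v A - c)) < \<epsilon> / 2"
      unfolding M.metric_closure_of using eps_pos by (auto dest!: spec[of _ "\<epsilon> / 2"])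
    then show ?thesis using C(2) vF eps_pos
      by (subst (asm) enn2real_norm_less_iff) (auto intro!: FIN_diff)
  qed
  then obtain g where g: "\<And>A. g A \<in> C" "\<And>A. \<Phi> (v A - g A) < ennreal (\<epsilon> / 2)" by metis
  have "inj g"
  proof (rule injI, rule ccontr)
    fix A A' assume gg: "g A = g A'" and "A \<noteq> A'"
    have "\<Phi> (v A - v A') \<le> \<Phi> (v A - g A) + \<Phi> (g A - v A')" by (rule norm_triangle3)
    also have "\<dots> < ennreal (\<epsilon> / 2) + ennreal (\<epsilon> / 2)"
      using g(2)[of A] g(2)[of A'] by (intro add_strict_mono) (auto simp: gg norm_diff_commute)
    also have "\<dots> = ennreal \<epsilon>" using eps_pos by (simp flip: ennreal_plus)
    finally show False using sep[OF \<open>A \<noteq> A'\<close>] by simp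
  qed
  moreover have "countable (range g)" using C(1) g(1) by (auto elim: countable_subset[rotated])
  ultimately have "countable (UNIV :: nat set set)" by (rule countable_image_inj_on[rotated])
  then have "from_nat_into (UNIV :: nat set set) ` UNIV = Pow UNIV"
    by (simp add: range_from_nat_into)
  then show False using Cantors_theorem[of "UNIV :: nat set"] by blast
qed

lemma EXH_not_borel_reducible_linf: "\<not> borel_reducible (coset_rel (EXH \<Phi>)) (coset_rel linf)"
proof
  assume "borel_reducible (coset_rel (EXH \<Phi>)) (coset_rel linf)"
  then obtain f where f: "f \<in> borel_measurable borel"
    "\<And>y z. y - z \<in> EXH \<Phi> \<longleftrightarrow> f y - f z \<in> linf"
    unfolding borel_reducible_def coset_rel_def by auto
  have "continuous_on UNIV (\<lambda>z. spread (row_weight z))"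
    by (rule continuous_on_compose2[OF continuous_on_spread continuous_on_row_weight]) simp
  then have "(\<lambda>z. spread (row_weight z)) \<in> borel_measurable borel" by (rule borel_measurable_continuous_onI)
  then have g: "(\<lambda>z. f (spread (row_weight z))) \<in> borel_measurable borel"
    using f(1) by (rule measurable_compose)
  show False
  proof (rule no_borel_reduction_fin_rows_linf[OF g])
    show "(\<lambda>i. z i \<noteq> z' i) \<in> fin_rows \<longleftrightarrow> f (spread (row_weight z)) - f (spread (row_weight z')) \<in> linf" for z z'
      unfolding f(2)[symmetric] spread_diff[symmetric] spread_in_EXH_iff row_weight_diff_c0_iff ..
  qed
qed

text \<open>The common criterion for both examples, with \<open>\<rho>\<close> the identity or
  \<open>floor_log\<close>. Finite subsums are \<open>spread\<close> of the masses
  \<open>y F\<close> collected at each index, and \<open>v \<ge> 0\<close> keeps these between 0 and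
  \<open>y A\<close>, so that \<open>y A\<close> alone decides convergence.\<close>

lemma unconditionally_convergent_spread_iff:
  fixes \<rho> :: "nat \<Rightarrow> nat" and v :: "nat \<Rightarrow> real"
  assumes fin: "\<And>k. finite {i \<in> A. \<rho> i = k}" and v: "\<And>i. v i \<ge> 0"
  shows "unconditionally_convergent \<Phi> (EXH \<Phi>) (\<lambda>i. spread (scale_seq (v i) (unit_seq (\<rho> i)))) A \<longleftrightarrow>
    (\<lambda>k. \<Sum>i\<in>{i \<in> A. \<rho> i = k}. v i) \<in> c0"
proof -
  let ?u = "\<lambda>i. spread (scale_seq (v i) (unit_seq (\<rho> i)))"
  define y where "y C k = (\<Sum>i\<in>{i \<in> C. \<rho> i = k}. v i)" for C k
  have y_nonneg: "y C k \<ge> 0" for C k unfolding y_def using v by (intro sum_nonneg) auto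
  have y_mono: "y F k \<le> y A k" if "F \<subseteq> A" for F k
    unfolding y_def using fin v that by (intro sum_mono2) auto
  have sum_u: "sum ?u F = spread (y F)" if "finite F" for F
  proof -
    have "(\<Sum>i\<in>F. scale_seq (v i) (unit_seq (\<rho> i))) k = y F k" for k
    proof -
      have "(\<Sum>i\<in>F. scale_seq (v i) (unit_seq (\<rho> i))) k = (\<Sum>i\<in>F. if \<rho> i = k then v i else 0)"
        unfolding sum_fun_apply by (rule sum.cong) (auto simp: scale_seq_def unit_seq_def)
      also have "\<dots> = y F k" unfolding y_def using that by (simp add: sum.inter_filter)
      finally show ?thesis .
    qed
    then have "(\<Sum>i\<in>F. scale_seq (v i) (unit_seq (\<rho> i))) = y F" by (rule ext)
    then show ?thesis unfolding spread_sum[symmetric] by simp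
  qed
  have "unconditionally_convergent \<Phi> (EXH \<Phi>) ?u A \<longleftrightarrow> y A \<in> c0"
  proof
    assume conv: "unconditionally_convergent \<Phi> (EXH \<Phi>) ?u A"
    have "y A \<longlonglongrightarrow> 0"
    proof (rule LIMSEQ_I)
      fix d :: real assume "d > 0"
      then have "d * \<epsilon> > 0" using eps_pos by simp
      obtain F0 where F0: "finite F0" "F0 \<subseteq> A"
        "\<And>F. finite F \<Longrightarrow> F0 \<subseteq> F \<Longrightarrow> F \<subseteq> A \<Longrightarrow> \<Phi> (sum ?u F - sum ?u F0) < ennreal (d * \<epsilon>)"
        by (rule unconditionally_convergentD[OF conv \<open>d * \<epsilon> > 0\<close>]) (rule that)
      have "finite (\<rho> ` F0)" using F0(1) by simp
      then have "\<exists>K. \<forall>k\<in>\<rho> ` F0. k < K" unfolding finite_nat_set_iff_bounded .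
      then obtain K where K: "\<forall>k\<in>\<rho> ` F0. k < K" ..
      have "norm (y A k - 0) < d" if "k \<ge> K" for k
      proof -
        \<comment> \<open>Adds the entire fibre over a \<open>k\<close> not met by
          \<open>F0\<close>, so that the two sums differ at index \<open>k\<close> by the full mass
          \<open>y A k\<close>.\<close>
        define F where "F = F0 \<union> {i \<in> A. \<rho> i = k}"
        have F: "finite F" "F0 \<subseteq> F" "F \<subseteq> A" using F0(1,2) fin by (auto simp: F_def)
        have k: "\<rho> i \<noteq> k" if "i \<in> F0" for i
          using bspec[OF K imageI[OF that]] \<open>k \<ge> K\<close> by simp
        then have "{i \<in> F. \<rho> i = k} = {i \<in> A. \<rho> i = k}" "{i \<in> F0. \<rho> i = k} = {}"
          using F0(2) by (auto simp: F_def)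
        then have "(y F - y F0) k = y A k"
          unfolding minus_apply y_def by (simp only: sum.empty diff_0_right)
        moreover have "ennreal (\<bar>(y F - y F0) k\<bar> * \<epsilon>) < ennreal (d * \<epsilon>)"
          using spread_lower F0(3)[OF F] unfolding sum_u[OF F(1)] sum_u[OF F0(1)] spread_diff[symmetric]
          by (rule le_less_trans)
        ultimately show ?thesis using eps_pos by (simp add: ennreal_less_iff)
      qed
      then show "\<exists>K. \<forall>k\<ge>K. norm (y A k - 0) < d" by blast
    qed
    then show "y A \<in> c0" by (simp add: c0_def)
  next
    assume c0: "y A \<in> c0"
    then have lim: "y A \<longlonglongrightarrow> 0" by (simp add: c0_def)
    show "unconditionally_convergent \<Phi> (EXH \<Phi>) ?u A"
      unfolding unconditionally_convergent_def limitin_norm_topology_iff[OF EXH_subset_FIN]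
    proof (intro exI[of _ "spread (y A)"] conjI allI impI)
      show "spread (y A) \<in> EXH \<Phi>" using c0 by (simp add: spread_in_EXH_iff)
      fix e :: real assume "e > 0"
      define d where "d = e / (2 * B)"
      have "d > 0" using \<open>e > 0\<close> B_pos by (simp add: d_def)
      then obtain K where K: "\<And>k. k \<ge> K \<Longrightarrow> \<bar>y A k\<bar> < d"
        using LIMSEQ_D[OF lim] by (auto simp: real_norm_def)
      \<comment> \<open>Complete fibres below \<open>K\<close> leave no error there; from
        \<open>K\<close> on the error is at most \<open>y A k < d\<close>.\<close>
      define F0 where "F0 = (\<Union>k<K. {i \<in> A. \<rho> i = k})"
      have F0: "finite F0" "F0 \<subseteq> A" unfolding F0_def using fin by auto
      have "sum ?u F \<in> EXH \<Phi> \<and> \<Phi> (sum ?u F - spread (y A)) < ennreal e"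
        if F: "finite F" "F0 \<subseteq> F" "F \<subseteq> A" for F
      proof
        show "sum ?u F \<in> EXH \<Phi>"
          by (rule EXH_sum) (rule spread_unit_in_EXH)
        have "\<bar>(y F - y A) k\<bar> \<le> d" for k
        proof (cases "k < K")
          case True
          then have "{i \<in> F. \<rho> i = k} = {i \<in> A. \<rho> i = k}" using F by (auto simp: F0_def)
          then show ?thesis using \<open>d > 0\<close> by (simp add: y_def)
        next
          case False
          then have "\<bar>y A k\<bar> < d" by (intro K) simp
          then show ?thesis using y_mono[OF F(3), of k] y_nonneg[of F k] y_nonneg[of A k]
            by (simp add: abs_if)
        qed
        then have "\<Phi> (spread (y F - y A)) \<le> ennreal (d * B)"
          using \<open>d > 0\<close> by (intro spread_upper) auto
        also have "\<dots> < ennreal e"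
          using \<open>e > 0\<close> B_pos by (intro ennreal_lessI) (auto simp: d_def)
        finally show "\<Phi> (sum ?u F - spread (y A)) < ennreal e"
          unfolding sum_u[OF F(1)] spread_diff .
      qed
      then show "\<forall>\<^sub>F F in finite_subsets_at_top A. sum ?u F \<in> EXH \<Phi> \<and> \<Phi> (sum ?u F - spread (y A)) < ennreal e"
        unfolding eventually_finite_subsets_at_top using F0 by (intro exI[of _ F0]) auto
    qed
  qed
  moreover have "y A = (\<lambda>k. \<Sum>i\<in>{i \<in> A. \<rho> i = k}. v i)" by (rule ext) (rule y_def)
  ultimately show ?thesis by simp
qed

text \<open>\<emptyset> \<times> Fin itself serves, represented by the \<open>i\<close>-th block
  scaled by \<open>(1 / 2) ^ row i\<close>.\<close>

lemma ex_representable_not_fsigma: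
  "\<exists>I. ideal_on UNIV I \<and> representable_on UNIV I \<Phi> (EXH \<Phi>) \<and> \<not> fsigma_family I"
proof (intro exI conjI)
  define I where "I = {A. (\<lambda>i. i \<in> A) \<in> fin_rows}"
  have I: "A \<in> I \<longleftrightarrow> (\<forall>m. finite {i \<in> A. row i = m})" for A
    by (simp add: I_def fin_rows_def)
  show "ideal_on UNIV I"
    unfolding ideal_on_def
  proof (intro conjI allI impI)
    show "B \<in> I" if "A \<in> I \<and> B \<subseteq> A" for A B
      unfolding I
    proof
      show "finite {i \<in> B. row i = m}" for m
        by (rule finite_subset[of _ "{i \<in> A. row i = m}"]) (use that I in auto)
    qed
    show "A \<union> B \<in> I" if "A \<in> I \<and> B \<in> I" for A B
      unfolding I
    proof
      show "finite {i \<in> A \<union> B. row i = m}" for m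
        by (rule finite_subset[of _ "{i \<in> A. row i = m} \<union> {i \<in> B. row i = m}"]) (use that I in auto)
    qed
  qed (auto simp: I)
  let ?u = "\<lambda>i. spread (scale_seq ((1 / 2) ^ row i) (unit_seq i))"
  have "unconditionally_convergent \<Phi> (EXH \<Phi>) ?u A \<longleftrightarrow> A \<in> I" for A
  proof -
    have eq: "{i \<in> A. i = k} = (if k \<in> A then {k} else {})" for k by auto
    have "unconditionally_convergent \<Phi> (EXH \<Phi>) ?u A \<longleftrightarrow>
      (\<lambda>k. \<Sum>i\<in>{i \<in> A. i = k}. (1 / 2) ^ row i) \<in> c0"
      by (rule unconditionally_convergent_spread_iff) (auto simp: eq)
    also have "(\<lambda>k. \<Sum>i\<in>{i \<in> A. i = k}. (1 / 2) ^ row i) = row_weight (\<lambda>i. i \<in> A)"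
      unfolding eq by (auto simp: row_weight_def)
    finally show ?thesis by (simp add: row_weight_c0_iff I_def)
  qed
  then show "representable_on UNIV I \<Phi> (EXH \<Phi>)"
    unfolding representable_on_def using spread_unit_in_EXH
    by (intro exI[of _ ?u]) auto
  have "Collect -` I = fin_rows" by (auto simp: I_def)
  then show "\<not> fsigma_family I" unfolding fsigma_family_def using fin_rows_not_fsigma by simp
qed

text \<open>Each \<open>i\<close> puts weight \<open>(1 / 2) ^ k\<close> on the block numbered by
  its dyadic interval \<open>k\<close>, so the mass collected there is the dyadic density.\<close>

lemma Z_ideal_representable: "representable_on (UNIV - {0}) Z_ideal \<Phi> (EXH \<Phi>)"
proof -
  let ?u = "\<lambda>i. spread (scale_seq ((1 / 2) ^ floor_log i) (unit_seq (floor_log i)))"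
  have "unconditionally_convergent \<Phi> (EXH \<Phi>) ?u A \<longleftrightarrow> A \<in> Z_ideal" if "A \<subseteq> UNIV - {0}" for A
  proof -
    have A: "0 \<notin> A" using that by blast
    have "unconditionally_convergent \<Phi> (EXH \<Phi>) ?u A \<longleftrightarrow>
      (\<lambda>k. \<Sum>i\<in>{i \<in> A. floor_log i = k}. (1 / 2) ^ floor_log i) \<in> c0"
      by (rule unconditionally_convergent_spread_iff[OF finite_floor_log_fibre[OF A]]) simp
    also have "(\<lambda>k. \<Sum>i\<in>{i \<in> A. floor_log i = k}. (1 / 2) ^ floor_log i) = dyadic_density A"
      by (simp add: dyadic_density_def fun_eq_iff power_one_over)
    finally show ?thesis by (simp add: Z_ideal_iff[OF A])
  qed
  moreover have "A \<subseteq> UNIV - {0}" if "A \<in> Z_ideal" for A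
    using that unfolding Z_ideal_def by (elim CollectE conjE)
  ultimately have "Z_ideal = {A. A \<subseteq> UNIV - {0} \<and> unconditionally_convergent \<Phi> (EXH \<Phi>) ?u A}" by auto
  moreover have "?u ` (UNIV - {0}) \<subseteq> EXH \<Phi>" by (rule image_subsetI) (rule spread_unit_in_EXH)
  ultimately show ?thesis unfolding representable_on_def by (intro exI[of _ ?u] conjI)
qed

end

section \<open>The equivalences, by cases on \<open>FIN \<Phi> = EXH \<Phi>\<close>\<close>

theorem theorem5p4:
  fixes \<Phi> :: "(nat \<Rightarrow> real) \<Rightarrow> ennreal"
  assumes "extended_norm \<Phi>" and "nice \<Phi>"
  shows
    "(FIN \<Phi> = EXH \<Phi> \<longleftrightarrow> fsigma_in euclidean (EXH \<Phi>)) \<and>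
     (FIN \<Phi> = EXH \<Phi> \<longleftrightarrow> \<not> contains_copy \<Phi> (EXH \<Phi>) sup_norm c0) \<and>
     (FIN \<Phi> = EXH \<Phi> \<longleftrightarrow> boundedly_complete_basis \<Phi> (EXH \<Phi>) unit_seq) \<and>
     (FIN \<Phi> = EXH \<Phi> \<longleftrightarrow> separable_space (norm_topology \<Phi> (FIN \<Phi>))) \<and>
     (FIN \<Phi> = EXH \<Phi> \<longleftrightarrow> borel_reducible (coset_rel (EXH \<Phi>)) (coset_rel linf)) \<and>
     (FIN \<Phi> = EXH \<Phi> \<longleftrightarrow>
        (\<forall>I. ideal_on UNIV I \<and> representable_on UNIV I \<Phi> (EXH \<Phi>) \<longrightarrow> fsigma_family I)) \<and>
     (FIN \<Phi> = EXH \<Phi> \<longleftrightarrow> \<not> representable_on (UNIV - {0}) Z_ideal \<Phi> (EXH \<Phi>)) \<and>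
     (FIN \<Phi> = EXH \<Phi> \<longleftrightarrow>
        (\<forall>\<sigma> :: nat \<Rightarrow> real. Exh_subm (\<lambda>A. \<Phi> (proj_on A \<sigma>)) = Fin_subm (\<lambda>A. \<Phi> (proj_on A \<sigma>))))"
proof -
  interpret nice_extended_norm \<Phi> by standard fact+
  show ?thesis
  proof (cases "FIN \<Phi> = EXH \<Phi>")
    case True
    \<comment> \<open>Both facts hold for \<open>FIN \<Phi>\<close> in either case and pass to
      \<open>EXH \<Phi>\<close> by the equation.\<close>
    have "fsigma_in euclidean (EXH \<Phi>)" "borel_reducible (coset_rel (EXH \<Phi>)) (coset_rel linf)"
      using fsigma_in_FIN FIN_borel_reducible_linf unfolding True .
    then show ?thesis
      using True FIN_eq_EXH_no_copy_c0[OF True] boundedly_complete_iff FIN_eq_EXH_separable[OF True]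
        FIN_eq_EXH_representable_fsigma[OF True] FIN_eq_EXH_Z_ideal_not_representable[OF True]
        submeasures_iff
      by blast
  next
    case False
    then obtain x where x: "x \<in> FIN \<Phi>" "x \<notin> EXH \<Phi>" using EXH_subset_FIN by blast
    obtain \<kappa> \<epsilon> where \<kappa>: "\<epsilon> > 0" "\<And>k. finite {i. \<kappa> i = (k::nat)}"
      "\<And>k. ennreal \<epsilon> \<le> \<Phi> (proj_on {i. \<kappa> i = k} x)"
      by (rule FIN_not_EXH_blocks[OF x]) (rule that)
    obtain B where B: "B > 0" "\<Phi> x \<le> ennreal B" using FIN_bound[OF x(1)] by blast
    interpret c0_block \<Phi> x \<kappa> \<epsilon> B by standard (fact \<kappa> B)+
    show ?thesis
      using False EXH_not_fsigma contains_copy_c0 boundedly_complete_iff FIN_not_separable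
        EXH_not_borel_reducible_linf ex_representable_not_fsigma Z_ideal_representable submeasures_iff
      by blast
  qed
qed

end
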